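(* Let $d\ge1$, let $m=(m_1,\dots,m_d)^\top\in\mathbb{Z}^d$, let $b_{1,1},b_{1,2},\dots,b_{d,1},b_{d,2}>0$ and $b:=\max\{b_{1,1},b_{1,2},\dots,b_{d,1},b_{d,2}\}$. Let $f:\mathbb{R}^d\to\mathbb{R}$ be a positive and symmetric function (i.e. $f(-\omega)=f(\omega)$) which is twice differentiable with $$\sup_{\omega\in\mathbb{R}^d}\Big|\frac{\partial f(\omega)}{\partial\omega_i}\Big|\le C_1,\qquad \sup_{\omega\in\mathbb{R}^d}\Big|\frac{\partial^2f(\omega)}{\partial\omega_i\,\partial\omega_j}\Big|\le C_2,\qquad \int_{\mathbb{R}^d}\Big|\frac{\partial f(\omega)}{\partial\omega_i}\Big|\,d\omega<\infty$$ for $i,j=1,\dots,d$ and some constants $C_1,C_2>0$. Let $h$ be a taper function as in the context. Then there is a constant $C>0$, independent of $b$ (and of $\lambda\ge1$, $m$ and $g$), such that the quantity $$R:=\frac1{\lambda^d}\Big|\int_{\mathbb{R}^d}B_{\lambda,d,h}(u)\,B_{\lambda,d,h}(\omega_{m,\lambda}-u)\Big(\int_{-b_{1,1}}^{b_{1,2}}\cdots\int_{-b_{d,1}}^{b_{d,2}}g(v)\,[f(u-v)-f(v)]\,dv\Big)du\Big|$$ satisfies: (i) if $g:\mathbb{R}^d\to\mathbb{R}$ is bounded, $$R\le C\,\sup_{v\in\mathbb{R}^d}|g(v)|\times\begin{cases}\dfrac{b^d}{\lambda^2},&\text{if }m_1=\dots=m_d=0,\\[2mm]\dfrac1\lambda+\dfrac{b^d}{\lambda^2},&\text{if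 }m_i\ne0\text{ for some }i\in\{1,\dots,d\};\end{cases}$$ (ii) if $g:\mathbb{R}^d\to\mathbb{R}$ is integrable, $$R\le C\int_{\mathbb{R}^d}|g(v)|\,dv\times\begin{cases}\dfrac1{\lambda^2},&\text{if }m_1=\dots=m_d=0,\\[2mm]\dfrac1\lambda,&\text{if }m_i\ne0\text{ for some }i\in\{1,\dots,d\}.\end{cases}$$
   Context: $h:\mathbb{R}^d\to[0,\infty)$ has product form $h(s)=\prod_{i=1}^dh_i(s_i)$, where each $h_i:\mathbb{R}\to[0,\infty)$ is symmetric, supported in $[-1/2,1/2]$ and twice differentiable on $\mathbb{R}$. For $\lambda>0$ the frequency window of $h$ is $B_{\lambda,d,h}(u):=\int_{[-\lambda/2,\lambda/2]^d}h(s/\lambda)\exp(-\mathrm{i}\,s^\top u)\,ds$, $u\in\mathbb{R}^d$. The Fourier frequencies are $\omega_{m,\lambda}:=(\frac{2\pi m_1}{\lambda},\dots,\frac{2\pi m_d}{\lambda})$. The asymptotic regime of interest is $\lambda\to\infty$. *)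

theory Defs
  imports "HOL-Analysis.Analysis"
begin

definition partial_deriv :: "'d \<Rightarrow> (real ^ 'd \<Rightarrow> real) \<Rightarrow> real ^ 'd \<Rightarrow> real" where
  "partial_deriv i f \<omega> = deriv (\<lambda>t. f (\<omega> + t *\<^sub>R axis i 1)) 0"

text \<open>Frechet differentiability of the total derivative of \<open>f\<close> is the same as
  Frechet differentiability of each of its finitely many components, the partial derivatives.\<close>

definition twice_differentiable :: "(real ^ 'd \<Rightarrow> real) \<Rightarrow> bool" where
  "twice_differentiable f \<longleftrightarrow>
     (\<forall>\<omega>. f differentiable (at \<omega>)) \<and>
     (\<forall>i \<omega>. partial_deriv i f differentiable (at \<omega>))"

definition taper_factor :: "(real \<Rightarrow> real) \<Rightarrow> bool" where
  "taper_factor k \<longleftrightarrow>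
     (\<forall>x. 0 \<le> k x) \<and>
     (\<forall>x. k (- x) = k x) \<and>
     (\<forall>x. x \<notin> {-1/2..1/2} \<longrightarrow> k x = 0) \<and>
     (\<forall>x. k differentiable (at x)) \<and>
     (\<forall>x. deriv k differentiable (at x))"

definition taper :: "(real ^ 'd \<Rightarrow> real) \<Rightarrow> bool" where
  "taper h \<longleftrightarrow>
     (\<exists>k. (\<forall>i. taper_factor (k i)) \<and> (\<forall>s. h s = (\<Prod>i\<in>UNIV. k i (s $ i))))"

definition freq_window :: "real \<Rightarrow> (real ^ 'd \<Rightarrow> real) \<Rightarrow> real ^ 'd \<Rightarrow> complex" where
  "freq_window lam h u =
     (LINT s : cbox (\<chi> i. - lam / 2) (\<chi> i. lam / 2) | lebesgue.
        complex_of_real (h (s /\<^sub>R lam)) * exp (- \<i> * complex_of_real (s \<bullet> u)))"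

definition fourier_freq :: "int ^ 'd \<Rightarrow> real \<Rightarrow> real ^ 'd" where
  "fourier_freq m lam = (\<chi> i. 2 * pi * real_of_int (m $ i) / lam)"

definition max_width :: "real ^ 'd \<Rightarrow> real ^ 'd \<Rightarrow> real" where
  "max_width b1 b2 = Max (range (\<lambda>i. b1 $ i) \<union> range (\<lambda>i. b2 $ i))"

text \<open>The iterated integral over \<open>v\<close> is read as the integral over the box
  \<open>cbox (- b1) b2\<close>, the product of the intervals from \<open>- b1 $ i\<close> to \<open>b2 $ i\<close>.\<close>

definition remainder ::
  "(real ^ 'd \<Rightarrow> real) \<Rightarrow> (real ^ 'd \<Rightarrow> real) \<Rightarrow> (real ^ 'd \<Rightarrow> real) \<Rightarrow>
   real ^ 'd \<Rightarrow> real ^ 'd \<Rightarrow> real \<Rightarrow> int ^ 'd \<Rightarrow> real" where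
  "remainder f h g b1 b2 lam m =
     1 / lam ^ CARD('d) *
     cmod (LINT u | lebesgue.
       freq_window lam h u * freq_window lam h (fourier_freq m lam - u) *
       complex_of_real (LINT v : cbox (- b1) b2 | lebesgue. g v * (f (u - v) - f v)))"

end

theory Submission
  imports Defs
begin

text \<open>The frequency window factorizes into rescaled Fourier transforms of the taper factors \<open>k\<close>.
  Since \<open>k''\<close> need not be integrable, pointwise decay of these transforms is not available; but
  \<open>k\<close> and \<open>k'\<close> are continuous with compact support, so by Bessel's inequality the
  transform of \<open>k\<close> has a finite second moment in the square mean, which gives
  \<open>\<integral> \<bar>u\<bar>\<^sup>j \<bar>B(u) B(w - u)\<bar> du = O(\<lambda>\<^sup>d / \<lambda>\<^sup>j)\<close> for \<open>j = 1\<close> and all \<open>w\<close>, and for \<open>j = 2\<close>, \<open>w = 0\<close>.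

  For \<open>m \<noteq> 0\<close> a first order bound on the inner integral suffices: for bounded \<open>g\<close> the difference
  \<open>f(v - u) - f(v)\<close> has \<open>L\<^sup>1\<close> norm at most \<open>\<Sum>\<^sub>i \<bar>u\<^sub>i\<bar> \<integral> \<bar>\<partial>\<^sub>i f\<bar>\<close>, uniformly in the box.
  For \<open>m = 0\<close> the weight \<open>B(u) B(- u)\<close> is even, so symmetrizing in \<open>u\<close> replaces the first difference
  of \<open>f\<close> by a second difference.\<close>

section \<open>Square integrability of Fourier transforms with compact support\<close>

text \<open>The distance from \<open>p\<close> to its orthogonal projection \<open>q\<close> onto
  the span of the \<open>e i\<close> is nonnegative, and its square expands to the squared norm of
  \<open>p\<close> minus the sum of the squared coefficients. Integrability is asked of exactly the
  products that occur in this expansion.\<close>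

lemma bessel_inequality:
  fixes e :: "'i \<Rightarrow> 'a \<Rightarrow> complex" and p :: "'a \<Rightarrow> complex"
  assumes fin: "finite I"
    and pp: "integrable M (\<lambda>s. p s * cnj (p s))"
    and pe: "\<And>i. i \<in> I \<Longrightarrow> integrable M (\<lambda>s. p s * cnj (e i s))"
    and ee: "\<And>i j. i \<in> I \<Longrightarrow> j \<in> I \<Longrightarrow> integrable M (\<lambda>s. e i s * cnj (e j s))"
    and orth: "\<And>i j. i \<in> I \<Longrightarrow> j \<in> I \<Longrightarrow>
      (LINT s|M. e i s * cnj (e j s)) = (if i = j then 1 else 0)"
  shows "(\<Sum>i\<in>I. (cmod (LINT s|M. p s * cnj (e i s)))\<^sup>2) \<le> (LINT s|M. (cmod (p s))\<^sup>2)"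
proof -
  define c where "c i = (LINT s|M. p s * cnj (e i s))" for i
  define S where "S = (\<Sum>i\<in>I. c i * cnj (c i))"
  have S: "S = of_real (\<Sum>i\<in>I. (cmod (c i))\<^sup>2)"
    unfolding S_def by (simp only: of_real_sum complex_norm_square)
  have ep: "integrable M (\<lambda>s. e i s * cnj (p s))" if "i \<in> I" for i
    using integrable_cnj[OF pe[OF that]] by (simp add: mult.commute)
  have epc: "(LINT s|M. e i s * cnj (p s)) = cnj (c i)" if "i \<in> I" for i
  proof -
    have "(\<lambda>s. e i s * cnj (p s)) = (\<lambda>s. cnj (p s * cnj (e i s)))"
      by (simp add: mult.commute)
    then show ?thesis by (simp only: c_def Bochner_Integration.integral_cnj)
  qed
  define q where "q s = (\<Sum>i\<in>I. c i * e i s)" for s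
  have eq: "(p s - q s) * cnj (p s - q s) = p s * cnj (p s)
      - (\<Sum>i\<in>I. cnj (c i) * (p s * cnj (e i s))) - (\<Sum>i\<in>I. c i * (e i s * cnj (p s)))
      + (\<Sum>i\<in>I. \<Sum>j\<in>I. (c i * cnj (c j)) * (e i s * cnj (e j s)))" for s
  proof -
    have "q s * cnj (q s) = (\<Sum>i\<in>I. \<Sum>j\<in>I. (c i * cnj (c j)) * (e i s * cnj (e j s)))"
      unfolding q_def cnj_sum sum_product by (simp add: mult_ac)
    moreover have "p s * cnj (q s) = (\<Sum>i\<in>I. cnj (c i) * (p s * cnj (e i s)))"
      unfolding q_def cnj_sum sum_distrib_left by (simp add: mult_ac)
    moreover have "q s * cnj (p s) = (\<Sum>i\<in>I. c i * (e i s * cnj (p s)))"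
      unfolding q_def sum_distrib_right by (simp add: mult_ac)
    ultimately show ?thesis by (simp add: algebra_simps)
  qed
  have i1: "integrable M (\<lambda>s. \<Sum>i\<in>I. cnj (c i) * (p s * cnj (e i s)))"
    by (intro Bochner_Integration.integrable_sum integrable_mult_right pe)
  have i2: "integrable M (\<lambda>s. \<Sum>i\<in>I. c i * (e i s * cnj (p s)))"
    by (intro Bochner_Integration.integrable_sum integrable_mult_right ep)
  have i3: "integrable M (\<lambda>s. \<Sum>i\<in>I. \<Sum>j\<in>I. (c i * cnj (c j)) * (e i s * cnj (e j s)))"
    by (intro Bochner_Integration.integrable_sum integrable_mult_right ee)
  have v1: "(LINT s|M. (\<Sum>i\<in>I. cnj (c i) * (p s * cnj (e i s)))) = S"
    by (subst Bochner_Integration.integral_sum)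
       (auto intro!: integrable_mult_right pe simp: S_def mult.commute simp flip: c_def)
  have v2: "(LINT s|M. (\<Sum>i\<in>I. c i * (e i s * cnj (p s)))) = S"
    by (subst Bochner_Integration.integral_sum)
       (auto intro!: integrable_mult_right ep sum.cong simp: S_def epc)
  have v3: "(LINT s|M. (\<Sum>i\<in>I. \<Sum>j\<in>I. (c i * cnj (c j)) * (e i s * cnj (e j s)))) = S"
  proof -
    have "(LINT s|M. (\<Sum>i\<in>I. \<Sum>j\<in>I. (c i * cnj (c j)) * (e i s * cnj (e j s))))
        = (\<Sum>i\<in>I. \<Sum>j\<in>I. (c i * cnj (c j)) * (LINT s|M. e i s * cnj (e j s)))"
      by (subst Bochner_Integration.integral_sum,
          (intro Bochner_Integration.integrable_sum integrable_mult_right ee; assumption),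
          intro sum.cong refl, subst Bochner_Integration.integral_sum)
         (auto intro!: integrable_mult_right ee)
    also have "\<dots> = (\<Sum>i\<in>I. \<Sum>j\<in>I. if i = j then c i * cnj (c j) else 0)"
      by (intro sum.cong refl) (simp add: orth)
    finally show ?thesis using fin by (simp add: S_def)
  qed
  \<comment> \<open>Both cross terms and the quadratic term in \<open>q\<close> integrate to
    \<open>S\<close>, so together they contribute -S - S + S = -S.\<close>
  have "(LINT s|M. (p s - q s) * cnj (p s - q s)) = (LINT s|M. p s * cnj (p s)) - S"
    unfolding eq using pp i1 i2 i3 v1 v2 v3 by (simp add: Bochner_Integration.integral_diff)
  moreover have "(LINT s|M. (p s - q s) * cnj (p s - q s))
      = of_real (LINT s|M. (cmod (p s - q s))\<^sup>2)"
    by (subst integral_complex_of_real[symmetric])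
      (simp only: complex_norm_square)
  moreover have "(LINT s|M. p s * cnj (p s)) = of_real (LINT s|M. (cmod (p s))\<^sup>2)"
    by (subst integral_complex_of_real[symmetric])
      (simp only: complex_norm_square)
  ultimately have "complex_of_real (LINT s|M. (cmod (p s - q s))\<^sup>2)
      = of_real ((LINT s|M. (cmod (p s))\<^sup>2) - (\<Sum>i\<in>I. (cmod (c i))\<^sup>2))"
    using S by simp
  then have "(LINT s|M. (cmod (p s - q s))\<^sup>2) =
      (LINT s|M. (cmod (p s))\<^sup>2) - (\<Sum>i\<in>I. (cmod (c i))\<^sup>2)"
    using of_real_eq_iff by blast
  moreover have "(LINT s|M. (cmod (p s - q s))\<^sup>2) \<ge> 0" by simp
  ultimately show ?thesis by (simp flip: c_def)
qed

text \<open>The sign in the exponent and the absence of a normalizing factor match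
  \<open>freq_window\<close>.\<close>

definition fourier :: "(real \<Rightarrow> real) \<Rightarrow> real \<Rightarrow> complex" where
  "fourier p x = (LINT s|lborel. complex_of_real (p s) * exp (- \<i> * complex_of_real (s * x)))"

text \<open>Orthonormality of the characters on an interval of length one. For nonzero
  \<open>k\<close> the antiderivative exp(w s)/w takes equal values at both ends because exp w =
  1.\<close>

lemma integral_exp_period:
  fixes k :: int
  shows "(LINT s|lborel. indicator {-1/2..1/2} s *\<^sub>R exp (2 * pi * \<i> * of_int k * of_real s)) = (if k = 0 then 1 else 0)"
proof (cases "k = 0")
  case True
  then show ?thesis by simp
next
  case False
  define w where "w = 2 * pi * \<i> * of_int k"
  have w: "w \<noteq> 0" using False by (simp add: w_def)
  have D: "((\<lambda>s::real. exp (w * of_real s) / w) has_vector_derivative exp (w * of_real x))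
      (at x within {-1/2..1/2})" for x
    by (rule has_vector_derivative_real_field)
      (auto intro!: derivative_eq_intros simp: w)
  have "(LINT s|lborel. indicator {-1/2..1/2} s *\<^sub>R exp (w * of_real s))
      = exp (w * of_real (1/2)) / w - exp (w * of_real (-1/2)) / w"
    by (rule integral_FTC_Icc[OF _ D]) (auto intro!: continuous_intros)
  also have "exp (w * of_real (1/2)) = exp (w * of_real (-1/2)) * exp w"
    unfolding exp_add[symmetric] by (simp add: field_simps)
  also have "exp w = 1"
    unfolding exp_eq_1 w_def by (auto simp: intro!: exI[of _ k])
  finally show ?thesis using False by (simp add: w_def)
qed

text \<open>The half-open intervals of length \<open>T\<close> starting at the integer multiples of
  \<open>T\<close> tile the line. Each is translated to [0,T), and sum and integral are exchanged by
  monotone convergence. The enumeration \<open>int_decode\<close> turns the sum over the integers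
  into a series over the naturals.\<close>

lemma nn_integral_eq_periodized:
  fixes q :: "real \<Rightarrow> ennreal"
  assumes [measurable]: "q \<in> borel_measurable borel" and "0 < T"
  shows "(\<integral>\<^sup>+x. q x \<partial>lborel) =
    (\<integral>\<^sup>+y\<in>{0..<T}. (\<Sum>n. q (T * of_int (int_decode n) + y)) \<partial>lborel)"
proof -
  define B where "B n = {T * of_int (int_decode n) ..< T * of_int (int_decode n) + T}" for n
  \<comment> \<open>Membership in a tile is a condition on a floor, which gives both disjointness
    and covering.\<close>
  have mem: "x \<in> B n \<longleftrightarrow> int_decode n = \<lfloor>x / T\<rfloor>" for x n
    using \<open>0 < T\<close> unfolding B_def eq_commute[of "int_decode n"] floor_eq_iff by (auto simp: field_simps)
  have disj: "disjoint_family B"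
  proof -
    have "m = n" if "x \<in> B m" "x \<in> B n" for x m n
      using that unfolding mem by (metis int_decode_inverse)
    then show ?thesis by (auto simp: disjoint_family_on_def)
  qed
  have "x \<in> (\<Union>n. B n)" for x
    unfolding UN_iff mem by (metis UNIV_I int_encode_inverse)
  then have un: "(\<Union>n. B n) = UNIV" by blast
  have "(\<integral>\<^sup>+x. q x \<partial>lborel) = (\<integral>\<^sup>+x\<in>(\<Union>n. B n). q x \<partial>lborel)"
    by (simp add: un)
  also have "\<dots> = (\<Sum>n. \<integral>\<^sup>+x\<in>B n. q x \<partial>lborel)"
    by (rule nn_integral_disjoint_family[OF _ _ disj]) (simp_all add: B_def)
  also have "(\<lambda>n. \<integral>\<^sup>+x\<in>B n. q x \<partial>lborel) = (\<lambda>n. \<integral>\<^sup>+y\<in>{0..<T}. q (T * of_int (int_decode n) + y) \<partial>lborel)"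
    unfolding B_def
    by (intro ext, subst nn_integral_real_affine[where c = 1 and t = "T * of_int (int_decode n)"])
      (auto intro!: nn_integral_cong simp: indicator_def)
  also have "(\<Sum>n. \<integral>\<^sup>+y\<in>{0..<T}. q (T * of_int (int_decode n) + y) \<partial>lborel)
     = (\<integral>\<^sup>+y\<in>{0..<T}. (\<Sum>n. q (T * of_int (int_decode n) + y)) \<partial>lborel)"
    by (subst nn_integral_suminf[symmetric]) (auto intro!: nn_integral_cong)
  finally show ?thesis .
qed

section \<open>Fourier transforms of continuous functions supported in [-1/2,1/2]\<close>

context
  fixes p :: "real \<Rightarrow> real"
  assumes cont: "continuous_on UNIV p" and supp: "\<And>x. x \<notin> {-1/2..1/2} \<Longrightarrow> p x = 0"
begin

lemma integrable_compact_support: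
  assumes "continuous_on UNIV g"
  shows "integrable lborel (\<lambda>s. complex_of_real (p s) * g s)"
proof -
  have "set_integrable lborel {-1/2..1/2} (\<lambda>s. complex_of_real (p s) * g s)"
    by (intro borel_integrable_atLeastAtMost' continuous_intros)
      (auto intro: continuous_on_subset[OF cont] continuous_on_subset[OF assms])
  moreover have "(\<lambda>s. indicator {-1/2..1/2} s *\<^sub>R (complex_of_real (p s) * g s))
      = (\<lambda>s. complex_of_real (p s) * g s)"
    using supp by (auto simp: indicator_def)
  ultimately show ?thesis by (simp add: set_integrable_def)
qed

lemma fourier_measurable: "fourier p \<in> borel_measurable borel"
proof -
  have [measurable]: "p \<in> borel_measurable borel"
    using cont by (rule borel_measurable_continuous_onI)
  show ?thesis unfolding fourier_def by measurable
qed

text \<open>Bessel's inequality on the support, applied to the characters shifted by \<open>y\<close>.\<close>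

lemma sum_fourier_le:
  assumes "finite I"
  shows "(\<Sum>k\<in>I. (cmod (fourier p (2 * pi * of_int k + y)))\<^sup>2) \<le> (LINT s|lborel. (p s)\<^sup>2)"
proof -
  define e where "e k s = indicator {-1/2..1/2} s *\<^sub>R exp (\<i> * of_real (s * (2 * pi * of_int k + y)))"
    for k :: int and s :: real
  \<comment> \<open>The indicator in \<open>e\<close> makes the characters orthonormal. Against
    \<open>p\<close> it disappears, since \<open>p\<close> vanishes off the interval, so the Bessel
    coefficients are values of \<open>fourier p\<close>.\<close>
  have pe: "complex_of_real (p s) * cnj (e k s)
      = complex_of_real (p s) * exp (- \<i> * complex_of_real (s * (2 * pi * of_int k + y)))" for k s
    using supp by (auto simp: e_def indicator_def exp_cnj)
  have ee: "e k s * cnj (e l s) = indicator {-1/2..1/2} s *\<^sub>R exp (2 * pi * \<i> * of_int (k - l) * of_real s)" for k l s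
    by (auto simp: e_def indicator_def exp_cnj algebra_simps simp flip: exp_add)
  have 1: "integrable lborel (\<lambda>s. complex_of_real (p s) * cnj (complex_of_real (p s)))"
    by (rule integrable_compact_support) (auto intro!: continuous_intros cont)
  have 2: "integrable lborel (\<lambda>s. complex_of_real (p s) * cnj (e k s))" for k
    unfolding pe by (rule integrable_compact_support) (auto intro!: continuous_intros)
  have 3: "integrable lborel (\<lambda>s. e k s * cnj (e l s))" for k l
    unfolding ee by (rule borel_integrable_compact) (auto intro!: continuous_intros)
  have 4: "(LINT s|lborel. e k s * cnj (e l s)) = (if k = l then 1 else 0)" for k l
    unfolding ee integral_exp_period by simp
  from bessel_inequality[OF assms 1 2 3 4] show ?thesis
    by (simp only: pe fourier_def norm_of_real power2_abs)
qed

text \<open>Splitting the line into periods of length 2 pi turns the integral into one over [0, 2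
  pi) of sums of squares at the frequencies 2 pi k + y. Bessel bounds each such sum by
  \<open>E\<close>, uniformly in \<open>y\<close>, so the total is at most 2 pi E. This is the upper
  half of Plancherel's identity.\<close>

lemma nn_integral_fourier_finite:
  "(\<integral>\<^sup>+x. ennreal ((cmod (fourier p x))\<^sup>2) \<partial>lborel) < \<infinity>"
proof -
  note [measurable] = fourier_measurable
  define E where "E = (LINT s|lborel. (p s)\<^sup>2)"
  \<comment> \<open>Bessel holds for finite index sets, so it bounds every partial sum and hence the
    series.\<close>
  have le: "(\<Sum>n. ennreal ((cmod (fourier p (2 * pi * of_int (int_decode n) + y)))\<^sup>2)) \<le> ennreal E" for y
  proof (rule suminf_le_const)
    fix N
    have "(\<Sum>n<N. (cmod (fourier p (2 * pi * of_int (int_decode n) + y)))\<^sup>2)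
       = (\<Sum>k\<in>int_decode ` {..<N}. (cmod (fourier p (2 * pi * of_int k + y)))\<^sup>2)"
      by (subst sum.reindex) (auto intro: inj_int_decode inj_on_subset)
    also have "\<dots> \<le> E" unfolding E_def by (rule sum_fourier_le) auto
    finally show "(\<Sum>n<N. ennreal ((cmod (fourier p (2 * pi * of_int (int_decode n) + y)))\<^sup>2)) \<le> ennreal E"
      by (simp add: ennreal_leI)
  qed auto
  have "(\<integral>\<^sup>+x. ennreal ((cmod (fourier p x))\<^sup>2) \<partial>lborel)
      = (\<integral>\<^sup>+y\<in>{0..<2 * pi}. (\<Sum>n. ennreal ((cmod (fourier p (2 * pi * of_int (int_decode n) + y)))\<^sup>2)) \<partial>lborel)"
    by (rule nn_integral_eq_periodized) simp_all
  also have "\<dots> \<le> (\<integral>\<^sup>+y. ennreal E * indicator {0..<2 * pi} y \<partial>lborel)"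
    by (intro nn_integral_mono mult_right_mono le) simp
  also have "\<dots> = ennreal E * ennreal (2 * pi)"
    by (subst nn_integral_cmult_indicator) auto
  also have "\<dots> < \<infinity>" by (simp add: ennreal_mult_less_top)
  finally show ?thesis .
qed

end

text \<open>Outside the closed interval \<open>k\<close> is locally zero, so its derivative vanishes
  there too. Twice differentiability provides continuity of \<open>deriv k\<close>, which makes the
  results above applicable to \<open>deriv k\<close> as well as to \<open>k\<close>.\<close>

lemma taper_factorD:
  assumes "taper_factor k"
  shows taper_factor_supp: "x \<notin> {-1/2..1/2} \<Longrightarrow> k x = 0"
    and taper_factor_deriv_supp: "x \<notin> {-1/2..1/2} \<Longrightarrow> deriv k x = 0"
    and taper_factor_deriv: "(k has_real_derivative deriv k x) (at x)"
    and taper_factor_cont: "continuous_on UNIV k"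
    and taper_factor_deriv_cont: "continuous_on UNIV (deriv k)"
proof -
  have supp: "k y = 0" if "y \<notin> {-1/2..1/2}" for y
    using assms that by (auto simp: taper_factor_def)
  then show "x \<notin> {-1/2..1/2} \<Longrightarrow> k x = 0" .
  have diff: "k differentiable (at y)" "deriv k differentiable (at y)" for y
    using assms by (auto simp: taper_factor_def)
  show "(k has_real_derivative deriv k x) (at x)"
    using diff(1) by (simp add: DERIV_deriv_iff_real_differentiable)
  show "continuous_on UNIV k" "continuous_on UNIV (deriv k)"
    using diff by (auto intro!: continuous_at_imp_continuous_on differentiable_imp_continuous_within)
  show "deriv k x = 0" if "x \<notin> {-1/2..1/2}"
  proof (rule DERIV_imp_deriv)
    have "open (- {-1/2..1/2 :: real})" by auto
    then show "(k has_real_derivative 0) (at x)"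
      by (rule has_field_derivative_transform_within_open[OF DERIV_const])
        (use that supp in auto)
  qed
qed

text \<open>Integration by parts: the derivative \<open>D\<close> of k(s) exp(-isx) integrates to
  zero because \<open>k\<close> has compact support.\<close>

lemma fourier_deriv:
  assumes k: "taper_factor k"
  shows "fourier (deriv k) x = \<i> * of_real x * fourier k x"
proof -
  note supp = taper_factor_supp[OF k] taper_factor_deriv_supp[OF k]
  define E where "E s = exp (- \<i> * complex_of_real (s * x))" for s
  have contE: "continuous_on A E" for A unfolding E_def by (intro continuous_intros)
  define D where "D s = of_real (deriv k s) * E s + of_real (k s) * (- \<i> * of_real x * E s)" for s
  have "((\<lambda>s. of_real (k s) * E s) has_vector_derivative D s) (at s within {-1..1})" for s
  proof -
    have "(E has_vector_derivative (- \<i> * of_real x * E s)) (at s within {-1..1})"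
      unfolding E_def
      by (rule has_vector_derivative_real_field[of "\<lambda>z. exp (- \<i> * (z * of_real x))", simplified of_real_mult[symmetric]])
        (auto intro!: derivative_eq_intros)
    moreover have "((\<lambda>s. complex_of_real (k s)) has_vector_derivative of_real (deriv k s)) (at s within {-1..1})"
      using has_vector_derivative_of_real[OF has_field_derivative_at_within[OF taper_factor_deriv[OF k]]] .
    ultimately show ?thesis
      unfolding D_def by (subst add.commute) (rule has_vector_derivative_mult)
  qed
  moreover have "continuous_on {-1..1} D" unfolding D_def
    by (intro continuous_intros contE continuous_on_of_real
      continuous_on_subset[OF taper_factor_cont[OF k]] continuous_on_subset[OF taper_factor_deriv_cont[OF k]]) auto
  \<comment> \<open>The interval [-1,1] exceeds the support strictly, so the boundary values vanish
    directly by the support condition.\<close>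
  ultimately have "(LINT s|lborel. indicator {-1..1} s *\<^sub>R D s) = of_real (k 1) * E 1 - of_real (k (-1)) * E (-1)"
    by (intro integral_FTC_Icc) auto
  also have "\<dots> = 0" using supp(1)[of 1] supp(1)[of "-1"] by simp
  also have "(\<lambda>s. indicator {-1..1} s *\<^sub>R D s) = D"
    using supp by (force simp: indicator_def D_def)
  finally have "(LINT s|lborel. D s) = 0" .
  moreover have "integrable lborel (\<lambda>s. of_real (deriv k s) * E s)"
    "integrable lborel (\<lambda>s. of_real (k s) * (- \<i> * of_real x * E s))"
    by (intro integrable_compact_support taper_factor_cont taper_factor_deriv_cont k supp
        continuous_intros contE; simp)+
  ultimately have "(LINT s|lborel. of_real (deriv k s) * E s) =
     - (LINT s|lborel. of_real (k s) * (- \<i> * of_real x * E s))"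
    unfolding D_def by (simp add: add_eq_0_iff2)
  also have "(LINT s|lborel. of_real (k s) * (- \<i> * of_real x * E s))
      = (LINT s|lborel. (- \<i> * of_real x) * (of_real (k s) * E s))"
    by (intro Bochner_Integration.integral_cong) auto
  also have "\<dots> = - \<i> * of_real x * (LINT s|lborel. of_real (k s) * E s)"
    by simp
  finally show ?thesis by (simp add: fourier_def E_def)
qed

text \<open>The second moment is the square integral of the transform of \<open>deriv k\<close>,
  since differentiation becomes multiplication by ix.\<close>

lemma fourier_moments_finite:
  assumes k: "taper_factor k"
  shows "(\<integral>\<^sup>+x. ennreal ((cmod (fourier k x))\<^sup>2) \<partial>lborel) < \<infinity>"
    and "(\<integral>\<^sup>+x. ennreal (x\<^sup>2 * (cmod (fourier k x))\<^sup>2) \<partial>lborel) < \<infinity>"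
proof -
  show "(\<integral>\<^sup>+x. ennreal ((cmod (fourier k x))\<^sup>2) \<partial>lborel) < \<infinity>"
    by (rule nn_integral_fourier_finite[OF taper_factor_cont[OF k] taper_factor_supp[OF k]])
  show "(\<integral>\<^sup>+x. ennreal (x\<^sup>2 * (cmod (fourier k x))\<^sup>2) \<partial>lborel) < \<infinity>"
    using nn_integral_fourier_finite[OF taper_factor_deriv_cont[OF k] taper_factor_deriv_supp[OF k]]
    unfolding fourier_deriv[OF k] by (simp add: norm_mult power_mult_distrib)
qed

section \<open>Moments of the frequency window\<close>

text \<open>Passes from products over \<open>Basis\<close>, the index set of \<open>lborel\<close>
  as a product measure, to products over coordinates.\<close>

lemma prod_Basis_axis:
  fixes F :: "real ^ 'd \<Rightarrow> 'a::comm_monoid_mult"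
  shows "(\<Prod>b\<in>Basis. F b) = (\<Prod>i\<in>UNIV. F (axis i 1))"
proof -
  have "Basis = range (\<lambda>i::'d. axis i (1::real))" by (auto simp: Basis_vec_def)
  moreover have "inj (\<lambda>i::'d. axis i (1::real))" by (auto simp: inj_on_def axis_eq_axis)
  ultimately show ?thesis using prod.reindex[of "\<lambda>i::'d. axis i (1::real)" UNIV F]
    by (metis (no_types, lifting) comp_apply prod.cong)
qed

lemma nn_integral_prod_cart:
  fixes f :: "'d::finite \<Rightarrow> real \<Rightarrow> ennreal"
  assumes "\<And>i. f i \<in> borel_measurable borel"
  shows "(\<integral>\<^sup>+x. (\<Prod>i\<in>UNIV. f i (x $ i)) \<partial>lborel) = (\<Prod>i\<in>UNIV. \<integral>\<^sup>+t. f i t \<partial>lborel)"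
  using nn_integral_lborel_prod[of "\<lambda>b::real^'d. f (axis_index b)"] assms
  by (simp add: prod_Basis_axis axis_index_axis inner_axis)

text \<open>Fubini for a product of one-variable functions: \<open>lborel\<close> is the image of
  the product measure indexed by \<open>Basis\<close>.\<close>

lemma integral_prod_cart:
  fixes f :: "'d::finite \<Rightarrow> real \<Rightarrow> complex"
  assumes "\<And>i. integrable lborel (f i)"
  shows "(LINT x|lborel. (\<Prod>i\<in>UNIV. f i (x $ i))) = (\<Prod>i\<in>UNIV. (LINT t|lborel. f i t))"
proof -
  interpret product_sigma_finite "\<lambda>b::real^'d. lborel :: real measure" by standard
  have [measurable]: "f i \<in> borel_measurable borel" for i
    using borel_measurable_integrable[OF assms] by simp
  let ?F = "\<lambda>x::real^'d. \<Prod>b\<in>Basis. f (axis_index b) (x \<bullet> b)"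
  have "(LINT x|lborel. (\<Prod>i\<in>UNIV. f i (x $ i))) = (LINT x|lborel. ?F x)"
    by (simp add: prod_Basis_axis axis_index_axis inner_axis)
  also have "\<dots> = (LINT x|(\<Pi>\<^sub>M b\<in>(Basis::(real^'d) set). lborel). ?F (\<Sum>b\<in>Basis. x b *\<^sub>R b))"
    by (subst lborel_eq, subst integral_distr) simp_all
  also have "\<dots> = (LINT x|(\<Pi>\<^sub>M b\<in>(Basis::(real^'d) set). lborel). (\<Prod>b\<in>Basis. f (axis_index b) (x b)))"
    by simp
  also have "\<dots> = (\<Prod>b\<in>(Basis::(real^'d) set). (LINT t|lborel. f (axis_index b) t))"
    by (rule product_integral_prod) (auto intro: assms)
  finally show ?thesis by (simp add: prod_Basis_axis axis_index_axis)
qed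

text \<open>The rescaled taper vanishes off the cube, so the integral extends to the whole space.
  There the taper and the exponential split over coordinates, Fubini applies, and substituting t =
  lam s gives one factor \<open>lam\<close> per coordinate.\<close>

lemma freq_window_prod:
  fixes h :: "real ^ 'd \<Rightarrow> real"
  assumes k: "\<And>i. taper_factor (k i)" and h: "\<And>s. h s = (\<Prod>i\<in>UNIV. k i (s $ i))"
    and lam: "0 < lam"
  shows "freq_window lam h u = (\<Prod>i\<in>UNIV. of_real lam * fourier (k i) (lam * u $ i))"
proof -
  note supp = taper_factor_supp[OF k]
  have [measurable]: "k i \<in> borel_measurable borel" for i
    using taper_factor_cont[OF k] by (rule borel_measurable_continuous_onI)
  let ?w = "\<lambda>i t. complex_of_real (k i (t / lam)) * exp (- \<i> * complex_of_real (t * u $ i))"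
  let ?B = "cbox (\<chi> i. - lam / 2) (\<chi> i. lam / 2) :: (real^'d) set"
  have w: "complex_of_real (h (s /\<^sub>R lam)) * exp (- \<i> * complex_of_real (s \<bullet> u)) = (\<Prod>i\<in>UNIV. ?w i (s $ i))" for s
    by (simp add: h prod.distrib inner_vec_def sum_distrib_left sum_negf[symmetric] exp_sum[symmetric] divide_inverse mult.commute)
  \<comment> \<open>A point outside the cube has a coordinate outside its interval, and that single
    factor is zero.\<close>
  have zero: "(\<Prod>i\<in>UNIV. ?w i (s $ i)) = 0" if "s \<notin> ?B" for s
  proof -
    from that obtain i where "s $ i \<notin> {- lam / 2..lam / 2}" by (auto simp: mem_box_cart)
    then have "s $ i / lam \<notin> {-1/2..1/2}" using lam by (auto simp: field_simps)
    then have "?w i (s $ i) = 0" using supp by simp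
    then show ?thesis by (metis (mono_tags, lifting) UNIV_I finite prod_zero_iff)
  qed
  have "(\<lambda>s. indicator ?B s *\<^sub>R (\<Prod>i\<in>UNIV. ?w i (s $ i))) = (\<lambda>s. \<Prod>i\<in>UNIV. ?w i (s $ i))"
    using zero by (auto simp: indicator_def)
  then have "freq_window lam h u = (LINT s|lebesgue. (\<Prod>i\<in>UNIV. ?w i (s $ i)))"
    unfolding freq_window_def set_lebesgue_integral_def w by simp
  also have "\<dots> = (LINT s|lborel. (\<Prod>i\<in>UNIV. ?w i (s $ i)))"
    by (rule integral_completion) measurable
  also have "\<dots> = (\<Prod>i\<in>UNIV. (LINT t|lborel. ?w i t))"
  proof (rule integral_prod_cart)
    fix i
    have "integrable lborel (\<lambda>t. complex_of_real (k i t) * exp (- \<i> * complex_of_real ((lam * t) * u $ i)))"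
      by (rule integrable_compact_support[OF taper_factor_cont[OF k] supp]) (auto intro!: continuous_intros)
    then show "integrable lborel (?w i)"
      using lam by (subst lborel_integrable_real_affine_iff[of lam _ 0, symmetric]) auto
  qed
  also have "\<dots> = (\<Prod>i\<in>UNIV. of_real lam * fourier (k i) (lam * u $ i))"
  proof (rule prod.cong[OF refl])
    fix i
    show "(LINT t|lborel. ?w i t) = of_real lam * fourier (k i) (lam * u $ i)"
      using lam by (subst lborel_integral_real_affine[of lam _ 0]) (auto simp: fourier_def scaleR_conv_of_real mult_ac)
  qed
  finally show ?thesis .
qed

lemma nn_integral_dilate:
  assumes [measurable]: "q \<in> borel_measurable borel" and "0 < lam"
  shows "(\<integral>\<^sup>+t. q (lam * t) \<partial>lborel) = (\<integral>\<^sup>+x. q x \<partial>lborel) / ennreal lam"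
proof -
  have "(\<integral>\<^sup>+x. q x \<partial>lborel) = ennreal lam * (\<integral>\<^sup>+t. q (lam * t) \<partial>lborel)"
    using assms nn_integral_real_affine[of q lam 0] by simp
  then show ?thesis using \<open>0 < lam\<close>
    by (simp only: mult.commute[of "ennreal lam"]) (simp add: ennreal_mult_divide_eq)
qed

text \<open>The sum of the finitely many finite moments bounds each of them; adding 1 makes the
  constant positive.\<close>

lemma taper_factor_moments_le:
  fixes k :: "'d::finite \<Rightarrow> real \<Rightarrow> real"
  assumes k: "\<And>i. taper_factor (k i)"
  obtains A where "0 < A"
    and "\<And>i. (\<integral>\<^sup>+x. ennreal ((cmod (fourier (k i) x))\<^sup>2) \<partial>lborel) \<le> ennreal A"
    and "\<And>i. (\<integral>\<^sup>+x. ennreal (x\<^sup>2 * (cmod (fourier (k i) x))\<^sup>2) \<partial>lborel) \<le> ennreal A"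
proof -
  define a where "a i = (\<integral>\<^sup>+x. ennreal ((cmod (fourier (k i) x))\<^sup>2) \<partial>lborel)" for i
  define c where "c i = (\<integral>\<^sup>+x. ennreal (x\<^sup>2 * (cmod (fourier (k i) x))\<^sup>2) \<partial>lborel)" for i
  define S where "S = (\<Sum>i\<in>UNIV. a i + c i)"
  have "S < top"
    using fourier_moments_finite[OF k] by (auto simp: S_def a_def c_def)
  then have S: "S \<le> ennreal (enn2real S + 1)"
    by (simp add: ennreal_plus)
  have "a i \<le> S" "c i \<le> S" for i
  proof -
    have "a i + c i \<le> S" unfolding S_def by (rule member_le_sum) auto
    then show "a i \<le> S" "c i \<le> S"
      by (metis le_iff_add order_trans, metis add.commute le_iff_add order_trans)
  qed
  then show ?thesis using S
    by (intro that[of "enn2real S + 1"])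
      (auto simp: add_nonneg_pos simp flip: a_def c_def intro: order_trans)
qed

text \<open>The squared window is a product over coordinates, so its moments are products of
  one-dimensional ones. Each plain factor is of order lam: lam^2 from the amplitude and 1/lam from
  the dilation. A factor weighted by t^2 is smaller by lam^2.\<close>

lemma freq_window_moments:
  fixes h :: "real ^ 'd \<Rightarrow> real"
  assumes "taper h"
  obtains P where "0 < P"
    and "\<And>lam. 0 < lam \<Longrightarrow> freq_window lam h \<in> borel_measurable borel"
    and "\<And>lam. 0 < lam \<Longrightarrow>
      (\<integral>\<^sup>+u. ennreal ((cmod (freq_window lam h u))\<^sup>2) \<partial>lborel) \<le> ennreal (P * lam ^ CARD('d))"
    and "\<And>lam i. 0 < lam \<Longrightarrow>
      (\<integral>\<^sup>+u. ennreal ((u $ i)\<^sup>2 * (cmod (freq_window lam h u))\<^sup>2) \<partial>lborel)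
        \<le> ennreal (P * lam ^ CARD('d) / lam\<^sup>2)"
proof -
  obtain k where k: "\<And>i. taper_factor (k i)" and h: "\<And>s. h s = (\<Prod>i\<in>UNIV. k i (s $ i))"
    using assms unfolding taper_def by blast
  obtain A where "0 < A"
    and A0: "\<And>i. (\<integral>\<^sup>+x. ennreal ((cmod (fourier (k i) x))\<^sup>2) \<partial>lborel) \<le> ennreal A"
    and A2: "\<And>i. (\<integral>\<^sup>+x. ennreal (x\<^sup>2 * (cmod (fourier (k i) x))\<^sup>2) \<partial>lborel) \<le> ennreal A"
    using taper_factor_moments_le[of k, OF k] by blast
  have meas[measurable]: "fourier (k i) \<in> borel_measurable borel" for i
    by (rule fourier_measurable[OF taper_factor_cont[OF k] taper_factor_supp[OF k]])
  have B: "freq_window lam h = (\<lambda>u. \<Prod>i\<in>UNIV. of_real lam * fourier (k i) (lam * u $ i))" if "0 < lam" for lam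
    using freq_window_prod[OF k h that] by blast
  define r where "r lam i t = (lam * cmod (fourier (k i) (lam * t)))\<^sup>2" for lam i t
  have r0: "0 \<le> r lam i t" for lam i t by (simp add: r_def)
  have r_meas[measurable]: "r lam i \<in> borel_measurable borel" for lam i
    unfolding r_def by measurable
  have Br: "(cmod (freq_window lam h u))\<^sup>2 = (\<Prod>i\<in>UNIV. r lam i (u $ i))" if "0 < lam" for lam u
    using that by (simp add: B r_def norm_mult prod_power_distrib flip: prod_norm)
  have le0: "(\<integral>\<^sup>+t. ennreal (r lam i t) \<partial>lborel) \<le> ennreal (lam * A)" if "0 < lam" for lam i
  proof -
    have "(\<integral>\<^sup>+t. ennreal (r lam i t) \<partial>lborel)
        = ennreal (lam\<^sup>2) * (\<integral>\<^sup>+t. ennreal ((cmod (fourier (k i) (lam * t)))\<^sup>2) \<partial>lborel)"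
      by (simp add: r_def power_mult_distrib ennreal_mult' nn_integral_cmult)
    also have "\<dots> = ennreal (lam\<^sup>2) * ((\<integral>\<^sup>+x. ennreal ((cmod (fourier (k i) x))\<^sup>2) \<partial>lborel) / ennreal lam)"
      using that by (subst nn_integral_dilate[of "\<lambda>x. ennreal ((cmod (fourier (k i) x))\<^sup>2)"]) auto
    also have "\<dots> \<le> ennreal (lam\<^sup>2) * (ennreal A / ennreal lam)"
      by (intro mult_left_mono divide_right_mono_ennreal A0) auto
    also have "\<dots> = ennreal (lam * A)"
      using that \<open>0 < A\<close> by (simp add: divide_ennreal power2_eq_square flip: ennreal_mult)
    finally show ?thesis .
  qed
  have le2: "(\<integral>\<^sup>+t. ennreal (t\<^sup>2 * r lam i t) \<partial>lborel) \<le> ennreal (A / lam)" if "0 < lam" for lam i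
  proof -
    have "(\<integral>\<^sup>+t. ennreal (t\<^sup>2 * r lam i t) \<partial>lborel)
        = (\<integral>\<^sup>+t. ennreal ((lam * t)\<^sup>2 * (cmod (fourier (k i) (lam * t)))\<^sup>2) \<partial>lborel)"
      by (simp add: r_def power_mult_distrib mult_ac)
    also have "\<dots> = (\<integral>\<^sup>+x. ennreal (x\<^sup>2 * (cmod (fourier (k i) x))\<^sup>2) \<partial>lborel) / ennreal lam"
      using that by (subst nn_integral_dilate[of "\<lambda>x. ennreal (x\<^sup>2 * (cmod (fourier (k i) x))\<^sup>2)"]) auto
    also have "\<dots> \<le> ennreal A / ennreal lam"
      by (intro divide_right_mono_ennreal A2)
    also have "\<dots> = ennreal (A / lam)" using that \<open>0 < A\<close> by (simp add: divide_ennreal)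
    finally show ?thesis .
  qed
  show ?thesis
  proof (rule that[of "A ^ CARD('d)"])
    show "0 < A ^ CARD('d)" using \<open>0 < A\<close> by simp
  next
    fix lam :: real assume "0 < lam"
    then show "freq_window lam h \<in> borel_measurable borel"
      by (subst B) measurable
  next
    fix lam :: real assume lam: "0 < lam"
    have "(\<integral>\<^sup>+u. ennreal ((cmod (freq_window lam h u))\<^sup>2) \<partial>lborel)
        = (\<integral>\<^sup>+u. (\<Prod>i\<in>UNIV. ennreal (r lam i (u $ i))) \<partial>lborel)"
      using lam by (simp add: Br r0 prod_ennreal)
    also have "\<dots> = (\<Prod>i\<in>UNIV. \<integral>\<^sup>+t. ennreal (r lam i t) \<partial>lborel)"
      by (rule nn_integral_prod_cart) simp
    also have "\<dots> \<le> (\<Prod>i\<in>(UNIV::'d set). ennreal (lam * A))"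
      by (intro prod_mono_ennreal le0 lam)
    also have "\<dots> = ennreal (A ^ CARD('d) * lam ^ CARD('d))"
      using lam \<open>0 < A\<close> by (simp add: ennreal_power power_mult_distrib mult.commute)
    finally show "(\<integral>\<^sup>+u. ennreal ((cmod (freq_window lam h u))\<^sup>2) \<partial>lborel)
        \<le> ennreal (A ^ CARD('d) * lam ^ CARD('d))" .
  next
    fix lam :: real and i :: 'd assume lam: "0 < lam"
    \<comment> \<open>The weight is moved into the factor of coordinate \<open>i\<close>, so that
      the integrand is again a product.\<close>
    let ?w = "\<lambda>j t. if j = i then t\<^sup>2 * r lam j t else r lam j t"
    have w: "(u $ i)\<^sup>2 * (cmod (freq_window lam h u))\<^sup>2 = (\<Prod>j\<in>UNIV. ?w j (u $ j))" for u
      using lam by (simp add: Br prod.remove[of UNIV i])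
    have "(\<integral>\<^sup>+u. ennreal ((u $ i)\<^sup>2 * (cmod (freq_window lam h u))\<^sup>2) \<partial>lborel)
        = (\<integral>\<^sup>+u. (\<Prod>j\<in>UNIV. ennreal (?w j (u $ j))) \<partial>lborel)"
      unfolding w by (subst prod_ennreal) (auto simp: r0)
    also have "\<dots> = (\<Prod>j\<in>UNIV. \<integral>\<^sup>+t. ennreal (?w j t) \<partial>lborel)"
      by (rule nn_integral_prod_cart) simp
    also have "\<dots> \<le> (\<Prod>j\<in>(UNIV::'d set). ennreal (if j = i then A / lam else lam * A))"
      using le0 le2 lam by (intro prod_mono_ennreal) auto
    also have "\<dots> = ennreal (A / lam * (lam * A) ^ (CARD('d) - 1))"
      using lam \<open>0 < A\<close> by (subst prod_ennreal) (auto simp: prod.remove[of UNIV i] card_Diff_singleton)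
    also have "A / lam * (lam * A) ^ (CARD('d) - 1) = A ^ CARD('d) * lam ^ CARD('d) / lam\<^sup>2"
    proof -
      \<comment> \<open>The dimension is positive, so the truncated subtraction in the exponent is a
        true one.\<close>
      obtain n where "CARD('d) = Suc n" using zero_less_card_finite gr0_conv_Suc by blast
      then show ?thesis using lam by (simp add: power_mult_distrib field_simps power2_eq_square)
    qed
    finally show "(\<integral>\<^sup>+u. ennreal ((u $ i)\<^sup>2 * (cmod (freq_window lam h u))\<^sup>2) \<partial>lborel)
        \<le> ennreal (A ^ CARD('d) * lam ^ CARD('d) / lam\<^sup>2)" .
  qed
qed

section \<open>Reflections and norm bounds for integrals\<close>

lemma nn_integral_lborel_reflect:
  fixes q :: "'a::euclidean_space \<Rightarrow> ennreal"
  assumes [measurable]: "q \<in> borel_measurable borel"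
  shows "(\<integral>\<^sup>+u. q (w - u) \<partial>lborel) = (\<integral>\<^sup>+u. q u \<partial>lborel)"
proof -
  have "lborel = distr lborel borel (\<lambda>u::'a. w - u)"
    using lborel_affine[of "-1" w] by (simp add: density_1)
  then have "(\<integral>\<^sup>+u. q u \<partial>lborel) = (\<integral>\<^sup>+u. q u \<partial>distr lborel borel (\<lambda>u. w - u))"
    by simp
  also have "\<dots> = (\<integral>\<^sup>+u. q (w - u) \<partial>lborel)"
    by (subst nn_integral_distr) simp_all
  finally show ?thesis ..
qed

text \<open>Stated for the completed measure, in which the outer integral of
  \<open>remainder\<close> is taken; the integrand there is not known to be Borel.\<close>

lemma
  fixes G :: "'a::euclidean_space \<Rightarrow> 'b::{banach, second_countable_topology}"
  assumes "integrable lebesgue G"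
  shows integrable_lebesgue_uminus: "integrable lebesgue (\<lambda>u. G (- u))"
    and integral_lebesgue_uminus: "(LINT u|lebesgue. G (- u)) = (LINT u|lebesgue. G u)"
proof -
  \<comment> \<open>Reflection written as the diagonal affine map with all factors -1; its density
    factor is 1.\<close>
  have T: "(\<lambda>x::'a. 0 + (\<Sum>j\<in>Basis. ((-1) * (x \<bullet> j)) *\<^sub>R j)) = uminus"
    by (auto simp: sum_negf euclidean_representation)
  have m: "uminus \<in> lebesgue \<rightarrow>\<^sub>M (lebesgue :: 'a measure)"
    using lebesgue_affine_measurable[of "\<lambda>_::'a. -1" 0] unfolding T by simp
  have d: "lebesgue = distr lebesgue lebesgue (uminus :: 'a \<Rightarrow> 'a)"
    using lebesgue_affine_euclidean[of "\<lambda>_::'a. -1" 0] unfolding T by (simp add: density_1)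
  have G: "G \<in> borel_measurable lebesgue" using assms by simp
  have "integrable (distr lebesgue lebesgue uminus) G" using assms d by simp
  then show "integrable lebesgue (\<lambda>u. G (- u))"
    by (rule integrable_distr[OF m])
  have "(LINT u|lebesgue. G u) = (LINT u|distr lebesgue lebesgue uminus. G u)" using d by simp
  also have "\<dots> = (LINT u|lebesgue. G (- u))"
    by (rule integral_distr[OF m]) (rule G)
  finally show "(LINT u|lebesgue. G (- u)) = (LINT u|lebesgue. G u)" ..
qed

text \<open>If \<open>G\<close> is not integrable, its Bochner integral is 0 by convention and the
  bound is trivial. Hence neither measurability nor integrability of the integrands has to be
  established below.\<close>

lemma norm_integral_le_nn_integral:
  fixes G :: "'a \<Rightarrow> 'b::{banach, second_countable_topology}"
  assumes "(\<integral>\<^sup>+u. ennreal (norm (G u)) \<partial>M) \<le> ennreal c" "0 \<le> c"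
  shows "norm (LINT u|M. G u) \<le> c"
proof (cases "integrable M G")
  case True
  then have "ennreal (norm (LINT u|M. G u)) \<le> ennreal c"
    using integral_norm_bound_ennreal assms order_trans by blast
  then show ?thesis using assms by simp
qed (use assms in \<open>simp add: not_integrable_integral_eq\<close>)

lemma nn_integral_cmult_sum_real:
  fixes H :: "'i \<Rightarrow> 'a \<Rightarrow> real"
  assumes [measurable]: "\<And>i. i \<in> I \<Longrightarrow> H i \<in> borel_measurable M"
    and H0: "\<And>i u. i \<in> I \<Longrightarrow> 0 \<le> H i u" and c: "0 \<le> c"
  shows "(\<integral>\<^sup>+u. ennreal (c * (\<Sum>i\<in>I. H i u)) \<partial>M) = ennreal c * (\<Sum>i\<in>I. \<integral>\<^sup>+u. ennreal (H i u) \<partial>M)"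
proof -
  have "(\<integral>\<^sup>+u. ennreal (c * (\<Sum>i\<in>I. H i u)) \<partial>M) = (\<integral>\<^sup>+u. ennreal c * (\<Sum>i\<in>I. ennreal (H i u)) \<partial>M)"
    using c H0 by (simp add: ennreal_mult' sum_ennreal)
  then show ?thesis
    by (simp add: nn_integral_cmult nn_integral_sum)
qed

text \<open>Separates the taper from \<open>f\<close> and \<open>g\<close>: \<open>K\<close> is
  chosen before \<open>F\<close>, the frequency \<open>w\<close> and the scale. A linear bound on
  \<open>F\<close> gains 1/lam; at zero frequency a quadratic bound on the even part of
  \<open>F\<close> gains 1/lam^2.\<close>

lemma freq_window_integral_le:
  fixes h :: "real ^ 'd \<Rightarrow> real"
  assumes "taper h"
  obtains K where "0 < K"
    and "\<And>lam w F M. 0 < lam \<Longrightarrow> 0 \<le> M \<Longrightarrow> (\<And>u. \<bar>F u\<bar> \<le> M * (\<Sum>i\<in>UNIV. \<bar>u $ i\<bar>)) \<Longrightarrow>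
      cmod (LINT u|lebesgue. freq_window lam h u * freq_window lam h (w - u) * complex_of_real (F u))
        \<le> lam ^ CARD('d) * (K * M / lam)"
    and "\<And>lam F M. 0 < lam \<Longrightarrow> 0 \<le> M \<Longrightarrow>
      (\<And>u. \<bar>F u + F (- u)\<bar> \<le> M * (\<Sum>i\<in>UNIV. \<bar>u $ i\<bar>)\<^sup>2) \<Longrightarrow>
      cmod (LINT u|lebesgue. freq_window lam h u * freq_window lam h (- u) * complex_of_real (F u))
        \<le> lam ^ CARD('d) * (K * M / lam\<^sup>2)"
proof -
  obtain P where "0 < P"
    and meas: "\<And>lam. 0 < lam \<Longrightarrow> freq_window lam h \<in> borel_measurable borel"
    and P0: "\<And>lam. 0 < lam \<Longrightarrow>
      (\<integral>\<^sup>+u. ennreal ((cmod (freq_window lam h u))\<^sup>2) \<partial>lborel) \<le> ennreal (P * lam ^ CARD('d))"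
    and P2: "\<And>lam i. 0 < lam \<Longrightarrow>
      (\<integral>\<^sup>+u. ennreal ((u $ i)\<^sup>2 * (cmod (freq_window lam h u))\<^sup>2) \<partial>lborel)
        \<le> ennreal (P * lam ^ CARD('d) / lam\<^sup>2)"
    using freq_window_moments[OF assms] by blast
  define d where "d = real CARD('d)"
  have d: "1 \<le> d" unfolding d_def using zero_less_card_finite[where 'a='d] by linarith
  show ?thesis
  \<comment> \<open>One factor \<open>d\<close> counts the coordinates, the other comes from
    Cauchy-Schwarz in the quadratic bound. As d is at least 1, the same constant covers the linear
    bound.\<close>
  proof (rule that[of "P * d * d"])
    show "0 < P * d * d" using \<open>0 < P\<close> d by simp
  next
    fix lam :: real and w :: "real ^ 'd" and F :: "real ^ 'd \<Rightarrow> real" and M :: real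
    assume lam: "0 < lam" and "0 \<le> M" and F: "\<And>u. \<bar>F u\<bar> \<le> M * (\<Sum>i\<in>UNIV. \<bar>u $ i\<bar>)"
    note [measurable] = meas[OF lam]
    let ?B = "\<lambda>u. cmod (freq_window lam h u)"
    \<comment> \<open>This is the arithmetic-geometric mean inequality for |u_i| B(u) and B(w - u).
      The weights lam/2 and 1/(2 lam) balance the two moments: each term integrates to at most P
      lam^d / (2 lam).\<close>
    define H where "H i u = lam / 2 * ((u $ i)\<^sup>2 * (?B u)\<^sup>2) + 1 / (2 * lam) * (?B (w - u))\<^sup>2" for i u
    have [measurable]: "H i \<in> borel_measurable borel" for i unfolding H_def by measurable
    have H0: "0 \<le> H i u" for i u using lam by (simp add: H_def)
    have amgm: "?B u * ?B (w - u) * \<bar>u $ i\<bar> \<le> H i u" for u i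
    proof -
      have "0 \<le> (lam * (\<bar>u $ i\<bar> * ?B u) - ?B (w - u))\<^sup>2" by simp
      then show ?thesis using lam unfolding H_def
        by (simp add: power2_diff power_mult_distrib field_simps power2_eq_square[of lam])
    qed
    have "cmod (freq_window lam h u * freq_window lam h (w - u) * complex_of_real (F u))
        \<le> M * (\<Sum>i\<in>UNIV. H i u)" for u
    proof -
      have "cmod (freq_window lam h u * freq_window lam h (w - u) * complex_of_real (F u))
          \<le> ?B u * ?B (w - u) * (M * (\<Sum>i\<in>UNIV. \<bar>u $ i\<bar>))"
        using F by (simp add: norm_mult mult_left_mono)
      also have "\<dots> = M * (\<Sum>i\<in>UNIV. ?B u * ?B (w - u) * \<bar>u $ i\<bar>)"
        by (simp add: sum_distrib_left mult_ac)
      also have "\<dots> \<le> M * (\<Sum>i\<in>UNIV. H i u)"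
        by (intro mult_left_mono sum_mono amgm \<open>0 \<le> M\<close>)
      finally show ?thesis .
    qed
    \<comment> \<open>Nonnegative integrals over a measure and its completion agree for every
      function, so \<open>F\<close> may be arbitrary here.\<close>
    then have "(\<integral>\<^sup>+u. ennreal (cmod (freq_window lam h u * freq_window lam h (w - u) * complex_of_real (F u))) \<partial>lebesgue)
        \<le> (\<integral>\<^sup>+u. ennreal (M * (\<Sum>i\<in>UNIV. H i u)) \<partial>lborel)"
      unfolding nn_integral_completion by (intro nn_integral_mono ennreal_leI)
    also have "\<dots> = ennreal M * (\<Sum>i\<in>UNIV. \<integral>\<^sup>+u. ennreal (H i u) \<partial>lborel)"
      by (rule nn_integral_cmult_sum_real) (simp_all add: H0 \<open>0 \<le> M\<close>)
    also have "\<dots> \<le> ennreal M * (\<Sum>i\<in>(UNIV::'d set). ennreal (P * lam ^ CARD('d) / lam))"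
    proof (intro mult_left_mono sum_mono)
      fix i :: 'd
      have "(\<integral>\<^sup>+u. ennreal (H i u) \<partial>lborel) = ennreal (lam / 2) * (\<integral>\<^sup>+u. ennreal ((u $ i)\<^sup>2 * (?B u)\<^sup>2) \<partial>lborel)
          + ennreal (1 / (2 * lam)) * (\<integral>\<^sup>+u. ennreal ((?B (w - u))\<^sup>2) \<partial>lborel)"
        unfolding H_def using lam
        by (simp add: ennreal_mult' nn_integral_add nn_integral_cmult del: times_divide_eq_left times_divide_eq_right)
      also have "(\<integral>\<^sup>+u. ennreal ((?B (w - u))\<^sup>2) \<partial>lborel) = (\<integral>\<^sup>+u. ennreal ((?B u)\<^sup>2) \<partial>lborel)"
        by (rule nn_integral_lborel_reflect) simp
      also have "ennreal (lam / 2) * (\<integral>\<^sup>+u. ennreal ((u $ i)\<^sup>2 * (?B u)\<^sup>2) \<partial>lborel)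
          + ennreal (1 / (2 * lam)) * (\<integral>\<^sup>+u. ennreal ((?B u)\<^sup>2) \<partial>lborel)
          \<le> ennreal (lam / 2) * ennreal (P * lam ^ CARD('d) / lam\<^sup>2)
          + ennreal (1 / (2 * lam)) * ennreal (P * lam ^ CARD('d))"
        by (intro add_mono mult_left_mono P0 P2 lam) auto
      also have "\<dots> = ennreal (lam / 2 * (P * lam ^ CARD('d) / lam\<^sup>2) + 1 / (2 * lam) * (P * lam ^ CARD('d)))"
        using lam \<open>0 < P\<close> by (simp flip: ennreal_mult ennreal_plus)
      also have "lam / 2 * (P * lam ^ CARD('d) / lam\<^sup>2) + 1 / (2 * lam) * (P * lam ^ CARD('d)) = P * lam ^ CARD('d) / lam"
        using lam by (simp add: field_simps power2_eq_square)
      finally show "(\<integral>\<^sup>+u. ennreal (H i u) \<partial>lborel) \<le> ennreal (P * lam ^ CARD('d) / lam)" .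
    qed auto
    also have "\<dots> = ennreal (M * (d * (P * lam ^ CARD('d) / lam)))"
      using \<open>0 \<le> M\<close> \<open>0 < P\<close> lam d
      by (subst sum_ennreal) (simp_all add: d_def flip: ennreal_mult')
    also have "\<dots> \<le> ennreal (lam ^ CARD('d) * (P * d * d * M / lam))"
    proof (rule ennreal_leI)
      have "M * (d * (P * lam ^ CARD('d) / lam)) * 1 \<le> M * (d * (P * lam ^ CARD('d) / lam)) * d"
        using d \<open>0 \<le> M\<close> \<open>0 < P\<close> lam by (intro mult_left_mono) auto
      then show "M * (d * (P * lam ^ CARD('d) / lam)) \<le> lam ^ CARD('d) * (P * d * d * M / lam)"
        by (simp add: mult_ac)
    qed
    finally show "cmod (LINT u|lebesgue. freq_window lam h u * freq_window lam h (w - u) * complex_of_real (F u))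
        \<le> lam ^ CARD('d) * (P * d * d * M / lam)"
      using d \<open>0 \<le> M\<close> \<open>0 < P\<close> lam by (intro norm_integral_le_nn_integral) auto
  next
    fix lam :: real and F :: "real ^ 'd \<Rightarrow> real" and M :: real
    assume lam: "0 < lam" and "0 \<le> M" and F: "\<And>u. \<bar>F u + F (- u)\<bar> \<le> M * (\<Sum>i\<in>UNIV. \<bar>u $ i\<bar>)\<^sup>2"
    note [measurable] = meas[OF lam]
    let ?B = "\<lambda>u. cmod (freq_window lam h u)"
    define G where "G u = freq_window lam h u * freq_window lam h (- u) * complex_of_real (F u)" for u
    define H where "H i u = (u $ i)\<^sup>2 * (?B u)\<^sup>2 + (u $ i)\<^sup>2 * (?B (- u))\<^sup>2" for i u
    have [measurable]: "H i \<in> borel_measurable borel" for i unfolding H_def by measurable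
    have H0: "0 \<le> H i u" for i u by (simp add: H_def)
    have G: "cmod (G u + G (- u)) \<le> M * d * (\<Sum>i\<in>UNIV. H i u)" for u
    proof -
      \<comment> \<open>The product of the windows at \<open>u\<close> and \<open>- u\<close> is
        even in \<open>u\<close>, so symmetrizing acts on \<open>F\<close> alone.\<close>
      have "G u + G (- u) = freq_window lam h u * freq_window lam h (- u) * complex_of_real (F u + F (- u))"
        by (simp add: G_def algebra_simps)
      then have "cmod (G u + G (- u)) = ?B u * ?B (- u) * \<bar>F u + F (- u)\<bar>"
        by (simp only: norm_mult norm_of_real)
      \<comment> \<open>The two windows are separated by the arithmetic-geometric mean inequality,
        and Cauchy-Schwarz bounds the squared sum of the |u_i| by d times the sum of
        squares.\<close>
      also have "\<dots> \<le> ((?B u)\<^sup>2 + (?B (- u))\<^sup>2) * (M * (d * (\<Sum>i\<in>UNIV. (u $ i)\<^sup>2)))"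
      proof (intro mult_mono)
        have "0 \<le> (?B u - ?B (- u))\<^sup>2" by simp
        then have "2 * (?B u * ?B (- u)) \<le> (?B u)\<^sup>2 + (?B (- u))\<^sup>2"
          by (simp add: power2_diff)
        moreover have "0 \<le> ?B u * ?B (- u)" by simp
        ultimately show "?B u * ?B (- u) \<le> (?B u)\<^sup>2 + (?B (- u))\<^sup>2" by linarith
        have "(\<Sum>i\<in>UNIV. \<bar>u $ i\<bar>)\<^sup>2 \<le> d * (\<Sum>i\<in>UNIV. (u $ i)\<^sup>2)"
          using sum_squared_le_sum_of_squares[of "\<lambda>i. \<bar>u $ i\<bar>" UNIV] by (simp add: d_def mult.commute)
        then show "\<bar>F u + F (- u)\<bar> \<le> M * (d * (\<Sum>i\<in>UNIV. (u $ i)\<^sup>2))"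
          using F[of u] \<open>0 \<le> M\<close> by (meson mult_left_mono order_trans)
      qed auto
      also have "\<dots> = M * d * (\<Sum>i\<in>UNIV. H i u)"
        by (simp add: H_def sum.distrib sum_distrib_left sum_distrib_right algebra_simps)
      finally show ?thesis .
    qed
    have "(\<integral>\<^sup>+u. ennreal (cmod (G u + G (- u))) \<partial>lebesgue) \<le> (\<integral>\<^sup>+u. ennreal (M * d * (\<Sum>i\<in>UNIV. H i u)) \<partial>lborel)"
      unfolding nn_integral_completion by (intro nn_integral_mono ennreal_leI G)
    also have "\<dots> = ennreal (M * d) * (\<Sum>i\<in>UNIV. \<integral>\<^sup>+u. ennreal (H i u) \<partial>lborel)"
      using \<open>0 \<le> M\<close> d by (intro nn_integral_cmult_sum_real) (simp_all add: H0)
    also have "\<dots> \<le> ennreal (M * d) * (\<Sum>i\<in>(UNIV::'d set). ennreal (2 * (P * lam ^ CARD('d) / lam\<^sup>2)))"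
    proof (intro mult_left_mono sum_mono)
      fix i :: 'd
      have "(\<integral>\<^sup>+u. ennreal (H i u) \<partial>lborel) = (\<integral>\<^sup>+u. ennreal ((u $ i)\<^sup>2 * (?B u)\<^sup>2) \<partial>lborel)
          + (\<integral>\<^sup>+u. ennreal ((u $ i)\<^sup>2 * (?B (- u))\<^sup>2) \<partial>lborel)"
        by (simp add: H_def nn_integral_add)
      also have "(\<integral>\<^sup>+u. ennreal ((u $ i)\<^sup>2 * (?B (- u))\<^sup>2) \<partial>lborel) = (\<integral>\<^sup>+u. ennreal ((u $ i)\<^sup>2 * (?B u)\<^sup>2) \<partial>lborel)"
        using nn_integral_lborel_reflect[of "\<lambda>u. ennreal ((u $ i)\<^sup>2 * (?B u)\<^sup>2)" 0] by simp
      also have "(\<integral>\<^sup>+u. ennreal ((u $ i)\<^sup>2 * (?B u)\<^sup>2) \<partial>lborel) + (\<integral>\<^sup>+u. ennreal ((u $ i)\<^sup>2 * (?B u)\<^sup>2) \<partial>lborel)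
          \<le> ennreal (P * lam ^ CARD('d) / lam\<^sup>2) + ennreal (P * lam ^ CARD('d) / lam\<^sup>2)"
        by (intro add_mono P2 lam)
      also have "\<dots> = ennreal (2 * (P * lam ^ CARD('d) / lam\<^sup>2))"
        using lam \<open>0 < P\<close> by (simp flip: ennreal_plus)
      finally show "(\<integral>\<^sup>+u. ennreal (H i u) \<partial>lborel) \<le> ennreal (2 * (P * lam ^ CARD('d) / lam\<^sup>2))" .
    qed auto
    also have "\<dots> = ennreal (M * d * (d * (2 * (P * lam ^ CARD('d) / lam\<^sup>2))))"
      using \<open>0 \<le> M\<close> \<open>0 < P\<close> lam d
      by (subst sum_ennreal) (simp_all add: d_def flip: ennreal_mult')
    also have "M * d * (d * (2 * (P * lam ^ CARD('d) / lam\<^sup>2))) = 2 * (lam ^ CARD('d) * (P * d * d * M / lam\<^sup>2))"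
      by simp
    finally have *: "cmod (LINT u|lebesgue. G u + G (- u)) \<le> 2 * (lam ^ CARD('d) * (P * d * d * M / lam\<^sup>2))"
      using d \<open>0 \<le> M\<close> \<open>0 < P\<close> lam by (intro norm_integral_le_nn_integral) auto
    \<comment> \<open>For integrable \<open>G\<close> the symmetrized integral is twice the
      original, which cancels the factor 2 in the bound; otherwise the integral is 0 by
      convention.\<close>
    have "cmod (LINT u|lebesgue. G u) \<le> lam ^ CARD('d) * (P * d * d * M / lam\<^sup>2)"
    proof (cases "integrable lebesgue G")
      case True
      then have "(LINT u|lebesgue. G u + G (- u)) = 2 * (LINT u|lebesgue. G u)"
        by (simp add: integrable_lebesgue_uminus integral_lebesgue_uminus)
      then show ?thesis using * by (simp add: norm_mult)
    next
      case False
      then show ?thesis using d \<open>0 \<le> M\<close> \<open>0 < P\<close> lam by (simp add: not_integrable_integral_eq)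
    qed
    then show "cmod (LINT u|lebesgue. freq_window lam h u * freq_window lam h (- u) * complex_of_real (F u))
        \<le> lam ^ CARD('d) * (P * d * d * M / lam\<^sup>2)"
      by (simp add: G_def)
  qed
qed

section \<open>Differences of the spectral density\<close>

text \<open>Chain rule along a line, with the total derivative expanded in the standard basis. The
  partial derivatives are its values on basis vectors.\<close>

lemma has_real_derivative_along_line:
  fixes p :: "real ^ 'd \<Rightarrow> real"
  assumes p: "\<And>x. p differentiable (at x)"
  shows "((\<lambda>t. p (v + t *\<^sub>R u)) has_real_derivative
      (\<Sum>i\<in>UNIV. u $ i * partial_deriv i p (v + t *\<^sub>R u))) (at t)"
proof -
  define D where "D x = frechet_derivative p (at x)" for x
  have D: "(p has_derivative D x) (at x)" for x
    using p frechet_derivative_works D_def by metis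
  have line: "((\<lambda>t. p (y + t *\<^sub>R w)) has_real_derivative D (y + t *\<^sub>R w) w) (at t)" for y w t
  proof -
    have "((\<lambda>t. y + t *\<^sub>R w) has_derivative (\<lambda>s. s *\<^sub>R w)) (at t)"
      by (auto intro!: derivative_eq_intros)
    from has_derivative_compose[OF this D]
    have "((\<lambda>t. p (y + t *\<^sub>R w)) has_derivative (\<lambda>s. D (y + t *\<^sub>R w) (s *\<^sub>R w))) (at t)" .
    moreover have "(\<lambda>s. D (y + t *\<^sub>R w) (s *\<^sub>R w)) = (*) (D (y + t *\<^sub>R w) w)"
      using linear_cmul[OF has_derivative_linear[OF D]] by (simp add: fun_eq_iff mult.commute)
    ultimately show ?thesis by (simp add: has_field_derivative_def)
  qed
  have pd: "partial_deriv i p x = D x (axis i 1)" for i x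
    unfolding partial_deriv_def using DERIV_imp_deriv[OF line[of x "axis i 1" 0]] by simp
  have lin: "linear (D x)" for x using D has_derivative_linear by blast
  have expand: "D x u = (\<Sum>i\<in>UNIV. u $ i * partial_deriv i p x)" for x
  proof -
    have "D x u = D x (\<Sum>i\<in>UNIV. u $ i *s axis i 1)" by (simp add: basis_expansion)
    also have "\<dots> = (\<Sum>i\<in>UNIV. u $ i * partial_deriv i p x)"
      using lin by (simp add: linear_sum linear_cmul pd scalar_mult_eq_scaleR)
    finally show ?thesis .
  qed
  show ?thesis using line[of v u t] by (simp only: expand)
qed

text \<open>Mean value bound in the l1 norm of the direction. It is kept general in \<open>p\<close>
  because it serves both for \<open>f\<close> and for its partial derivatives.\<close>

lemma abs_diff_along_line_le:
  fixes p :: "real ^ 'd \<Rightarrow> real"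
  assumes p: "\<And>x. p differentiable (at x)" and C: "\<And>i x. \<bar>partial_deriv i p x\<bar> \<le> C"
  shows "\<bar>p (v + t *\<^sub>R u) - p (v + s *\<^sub>R u)\<bar> \<le> C * \<bar>t - s\<bar> * (\<Sum>i\<in>UNIV. \<bar>u $ i\<bar>)"
proof -
  have "norm (p (v + t *\<^sub>R u) - p (v + s *\<^sub>R u)) \<le> C * (\<Sum>i\<in>UNIV. \<bar>u $ i\<bar>) * norm (t - s)"
  proof (rule field_differentiable_bound[OF convex_UNIV])
    fix r
    show "((\<lambda>t. p (v + t *\<^sub>R u)) has_field_derivative
        (\<Sum>i\<in>UNIV. u $ i * partial_deriv i p (v + r *\<^sub>R u))) (at r within UNIV)"
      using has_real_derivative_along_line[OF p] by simp
    have "norm (\<Sum>i\<in>UNIV. u $ i * partial_deriv i p (v + r *\<^sub>R u))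
        \<le> (\<Sum>i\<in>UNIV. \<bar>u $ i\<bar> * \<bar>partial_deriv i p (v + r *\<^sub>R u)\<bar>)"
      by (rule order_trans[OF norm_sum]) (simp add: abs_mult)
    also have "\<dots> \<le> (\<Sum>i\<in>UNIV. \<bar>u $ i\<bar> * C)" by (intro sum_mono mult_left_mono C) simp
    finally show "norm (\<Sum>i\<in>UNIV. u $ i * partial_deriv i p (v + r *\<^sub>R u)) \<le> C * (\<Sum>i\<in>UNIV. \<bar>u $ i\<bar>)"
      by (simp add: sum_distrib_left mult.commute)
  qed auto
  then show ?thesis by (simp add: mult_ac)
qed

text \<open>The mean value theorem on each side of \<open>v\<close> writes the second difference as
  D x - D y with x in (0,1) and y in (-1,0), and \<open>D\<close> is Lipschitz because the partial
  derivatives are. No integral remainder appears, since the second partial derivatives need not be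
  continuous.\<close>

lemma second_difference_le:
  fixes f :: "real ^ 'd \<Rightarrow> real"
  assumes f: "twice_differentiable f"
    and C: "\<And>i j x. \<bar>partial_deriv i (partial_deriv j f) x\<bar> \<le> C"
  shows "\<bar>f (v + u) + f (v - u) - 2 * f v\<bar> \<le> 2 * C * (\<Sum>i\<in>UNIV. \<bar>u $ i\<bar>)\<^sup>2"
proof -
  have f1: "\<And>x. f differentiable (at x)" and f2: "\<And>i x. partial_deriv i f differentiable (at x)"
    using f by (auto simp: twice_differentiable_def)
  define S where "S = (\<Sum>i\<in>UNIV. \<bar>u $ i\<bar>)"
  define D where "D t = (\<Sum>i\<in>UNIV. u $ i * partial_deriv i f (v + t *\<^sub>R u))" for t
  have der: "((\<lambda>t. f (v + t *\<^sub>R u)) has_real_derivative D t) (at t)" for t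
    unfolding D_def by (rule has_real_derivative_along_line[OF f1])
  have D: "\<bar>D t - D s\<bar> \<le> C * \<bar>t - s\<bar> * S\<^sup>2" for t s
  proof -
    have "\<bar>D t - D s\<bar> = \<bar>\<Sum>i\<in>UNIV. u $ i * (partial_deriv i f (v + t *\<^sub>R u) - partial_deriv i f (v + s *\<^sub>R u))\<bar>"
      by (simp add: D_def sum_subtractf right_diff_distrib)
    also have "\<dots> \<le> (\<Sum>i\<in>UNIV. \<bar>u $ i\<bar> * \<bar>partial_deriv i f (v + t *\<^sub>R u) - partial_deriv i f (v + s *\<^sub>R u)\<bar>)"
      by (rule order_trans[OF sum_abs]) (simp add: abs_mult)
    also have "\<dots> \<le> (\<Sum>i\<in>UNIV. \<bar>u $ i\<bar> * (C * \<bar>t - s\<bar> * S))"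
      unfolding S_def by (intro sum_mono mult_left_mono abs_diff_along_line_le f2 C) simp
    also have "\<dots> = C * \<bar>t - s\<bar> * S\<^sup>2"
      unfolding sum_distrib_right[symmetric] S_def[symmetric] by (simp add: power2_eq_square)
    finally show ?thesis .
  qed
  obtain x where x: "0 < x" "x < 1" "f (v + 1 *\<^sub>R u) - f (v + 0 *\<^sub>R u) = (1 - 0) * D x"
    using MVT2[of 0 1 "\<lambda>t. f (v + t *\<^sub>R u)" D] der by auto
  obtain y where y: "-1 < y" "y < 0" "f (v + 0 *\<^sub>R u) - f (v + (-1) *\<^sub>R u) = (0 - (-1)) * D y"
    using MVT2[of "-1" 0 "\<lambda>t. f (v + t *\<^sub>R u)" D] der by auto
  have "0 \<le> C" using C abs_ge_zero order_trans by blast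
  have "\<bar>f (v + u) + f (v - u) - 2 * f v\<bar> = \<bar>D x - D y\<bar>" using x(3) y(3) by simp
  also have "\<dots> \<le> C * \<bar>x - y\<bar> * S\<^sup>2" by (rule D)
  also have "\<dots> \<le> C * 2 * S\<^sup>2" using x y \<open>0 \<le> C\<close> by (intro mult_right_mono mult_left_mono) auto
  finally show ?thesis by (simp add: S_def mult_ac)
qed

lemma nn_integral_lborel_translate:
  fixes q :: "'a::euclidean_space \<Rightarrow> ennreal"
  assumes [measurable]: "q \<in> borel_measurable borel"
  shows "(\<integral>\<^sup>+v. q (v + c) \<partial>lborel) = (\<integral>\<^sup>+v. q v \<partial>lborel)"
proof -
  have "(\<integral>\<^sup>+v. q v \<partial>lborel) = (\<integral>\<^sup>+v. q v \<partial>distr lborel borel ((+) c))"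
    by (simp add: lborel_distr_plus)
  also have "\<dots> = (\<integral>\<^sup>+v. q (v + c) \<partial>lborel)"
    by (subst nn_integral_distr) (simp_all add: add.commute)
  finally show ?thesis ..
qed

text \<open>The difference is the integral over t in [0,1] of the derivative along the segment.
  After exchanging the integrals, translation invariance removes the shift t u, and each coordinate
  contributes |u_i| times the L1 norm of a partial derivative.\<close>

lemma nn_integral_difference_le:
  fixes f :: "real ^ 'd \<Rightarrow> real"
  assumes f: "twice_differentiable f"
  shows "(\<integral>\<^sup>+v. ennreal \<bar>f (v + u) - f v\<bar> \<partial>lborel)
    \<le> (\<Sum>i\<in>UNIV. ennreal \<bar>u $ i\<bar> * (\<integral>\<^sup>+v. ennreal \<bar>partial_deriv i f v\<bar> \<partial>lborel))"
proof -
  have f1: "\<And>x. f differentiable (at x)" and f2: "\<And>i x. partial_deriv i f differentiable (at x)"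
    using f by (auto simp: twice_differentiable_def)
  have cont: "continuous_on A (partial_deriv i f)" for i A
    using f2 by (intro continuous_at_imp_continuous_on ballI differentiable_imp_continuous_within)
  have [measurable]: "partial_deriv i f \<in> borel_measurable borel" for i
    by (rule borel_measurable_continuous_onI[OF cont])
  have pt: "ennreal \<bar>f (v + u) - f v\<bar>
      \<le> (\<integral>\<^sup>+t. indicator {0..1} t * (\<Sum>i\<in>UNIV. ennreal \<bar>u $ i\<bar> * ennreal \<bar>partial_deriv i f (v + t *\<^sub>R u)\<bar>) \<partial>lborel)" for v
  proof -
    define D where "D t = (\<Sum>i\<in>UNIV. u $ i * partial_deriv i f (v + t *\<^sub>R u))" for t
    have der: "((\<lambda>t. f (v + t *\<^sub>R u)) has_vector_derivative D t) (at t within {0..1})" for t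
      unfolding D_def
      by (rule has_vector_derivative_at_within, rule has_real_derivative_iff_has_vector_derivative[THEN iffD1],
          rule has_real_derivative_along_line[OF f1])
    have "continuous_on {0..1} D"
      unfolding D_def by (intro continuous_intros continuous_on_compose2[OF cont[of UNIV]]) auto
    have "has_bochner_integral lborel (\<lambda>t. indicator {0..1} t *\<^sub>R D t) (f (v + 1 *\<^sub>R u) - f (v + 0 *\<^sub>R u))"
      by (rule has_bochner_integral_FTC_Icc) (simp, rule der, fact)
    from has_bochner_integral_norm_bound[OF this]
    have "ennreal \<bar>f (v + u) - f v\<bar> \<le> (\<integral>\<^sup>+t. ennreal (norm (indicator {0..1} t *\<^sub>R D t)) \<partial>lborel)"
      by (simp only: real_norm_def scaleR_one scaleR_zero_left add_0_right)
    also have "\<dots> \<le> (\<integral>\<^sup>+t. indicator {0..1} t * (\<Sum>i\<in>UNIV. ennreal \<bar>u $ i\<bar> * ennreal \<bar>partial_deriv i f (v + t *\<^sub>R u)\<bar>) \<partial>lborel)"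
    proof (intro nn_integral_mono)
      fix t :: real
      have "\<bar>D t\<bar> \<le> (\<Sum>i\<in>UNIV. \<bar>u $ i\<bar> * \<bar>partial_deriv i f (v + t *\<^sub>R u)\<bar>)"
        unfolding D_def by (rule order_trans[OF sum_abs]) (simp add: abs_mult)
      then have "ennreal \<bar>D t\<bar> \<le> (\<Sum>i\<in>UNIV. ennreal \<bar>u $ i\<bar> * ennreal \<bar>partial_deriv i f (v + t *\<^sub>R u)\<bar>)"
        by (simp add: ennreal_leI flip: ennreal_mult')
      then show "ennreal (norm (indicator {0..1} t *\<^sub>R D t)) \<le> indicator {0..1} t * (\<Sum>i\<in>UNIV. ennreal \<bar>u $ i\<bar> * ennreal \<bar>partial_deriv i f (v + t *\<^sub>R u)\<bar>)"
        by (simp add: indicator_def)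
    qed
    finally show ?thesis .
  qed
  have "(\<integral>\<^sup>+v. ennreal \<bar>f (v + u) - f v\<bar> \<partial>lborel)
      \<le> (\<integral>\<^sup>+v. (\<integral>\<^sup>+t. indicator {0..1} t * (\<Sum>i\<in>UNIV. ennreal \<bar>u $ i\<bar> * ennreal \<bar>partial_deriv i f (v + t *\<^sub>R u)\<bar>) \<partial>lborel) \<partial>lborel)"
    by (intro nn_integral_mono pt)
  also have "\<dots> = (\<integral>\<^sup>+t. (\<integral>\<^sup>+v. indicator {0..1} t * (\<Sum>i\<in>UNIV. ennreal \<bar>u $ i\<bar> * ennreal \<bar>partial_deriv i f (v + t *\<^sub>R u)\<bar>) \<partial>lborel) \<partial>lborel)"
    by (rule lborel_pair.Fubini') measurable
  also have "\<dots> = (\<integral>\<^sup>+t. indicator {0..1::real} t * (\<Sum>i\<in>UNIV. ennreal \<bar>u $ i\<bar> * (\<integral>\<^sup>+v. ennreal \<bar>partial_deriv i f v\<bar> \<partial>lborel)) \<partial>lborel)"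
  proof (rule nn_integral_cong)
    fix t :: real
    have "(\<integral>\<^sup>+v. ennreal \<bar>partial_deriv i f (v + t *\<^sub>R u)\<bar> \<partial>lborel) = (\<integral>\<^sup>+v. ennreal \<bar>partial_deriv i f v\<bar> \<partial>lborel)" for i
      by (rule nn_integral_lborel_translate[of "\<lambda>v. ennreal \<bar>partial_deriv i f v\<bar>"]) simp
    then show "(\<integral>\<^sup>+v. indicator {0..1} t * (\<Sum>i\<in>UNIV. ennreal \<bar>u $ i\<bar> * ennreal \<bar>partial_deriv i f (v + t *\<^sub>R u)\<bar>) \<partial>lborel)
        = indicator {0..1} t * (\<Sum>i\<in>UNIV. ennreal \<bar>u $ i\<bar> * (\<integral>\<^sup>+v. ennreal \<bar>partial_deriv i f v\<bar> \<partial>lborel))"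
      by (simp add: nn_integral_cmult nn_integral_sum)
  qed
  also have "\<dots> = (\<Sum>i\<in>UNIV. ennreal \<bar>u $ i\<bar> * (\<integral>\<^sup>+v. ennreal \<bar>partial_deriv i f v\<bar> \<partial>lborel))"
    by (simp add: nn_integral_multc)
  finally show ?thesis .
qed

text \<open>The Lipschitz bound on \<open>f\<close> is uniform in \<open>v\<close>, so the truncated
  \<open>g\<close> serves as integrable majorant up to a constant.\<close>

lemma
  fixes f g :: "real ^ 'd \<Rightarrow> real"
  assumes f: "\<And>x. f differentiable (at x)" and sym: "\<And>x. f (- x) = f x"
    and C: "\<And>i x. \<bar>partial_deriv i f x\<bar> \<le> C"
    and g: "integrable lebesgue (\<lambda>v. indicator A v * g v)"
  shows integrable_indicator_mult_difference:
      "integrable lebesgue (\<lambda>v. indicator A v * (g v * (f (u - v) - f v)))"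
    and integral_indicator_mult_difference_le:
      "\<bar>LINT v|lebesgue. indicator A v * (g v * (f (u - v) - f v))\<bar>
      \<le> C * (LINT v|lebesgue. \<bar>indicator A v * g v\<bar>) * (\<Sum>i\<in>UNIV. \<bar>u $ i\<bar>)"
proof -
  let ?S = "\<Sum>i\<in>UNIV. \<bar>u $ i\<bar>"
  have d: "\<bar>f (u - v) - f v\<bar> \<le> C * ?S" for v
    \<comment> \<open>By symmetry f(u - v) = f(v - u), a shift of the argument \<open>v\<close> by
      \<open>- u\<close>.\<close>
    using abs_diff_along_line_le[OF f C, of v 1 "- u" 0] sym[of "u - v"] by simp
  have "continuous_on UNIV f"
    using f by (intro continuous_at_imp_continuous_on ballI differentiable_imp_continuous_within)
  then have [measurable]: "f \<in> borel_measurable borel" by (rule borel_measurable_continuous_onI)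
  have dm: "(\<lambda>v. f (u - v) - f v) \<in> borel_measurable lebesgue"
    by (rule measurable_completion) measurable
  have eq: "indicator A v * (g v * (f (u - v) - f v)) = (indicator A v * g v) * (f (u - v) - f v)" for v
    by simp
  have bd: "\<bar>indicator A v * (g v * (f (u - v) - f v))\<bar> \<le> C * ?S * \<bar>indicator A v * g v\<bar>" for v
    unfolding eq abs_mult[of "indicator A v * g v"] using mult_left_mono[OF d, of "\<bar>indicator A v * g v\<bar>" v]
    by (simp add: mult_ac)
  have gi: "integrable lebesgue (\<lambda>v. C * ?S * \<bar>indicator A v * g v\<bar>)"
    using g by (intro integrable_mult_right integrable_abs)
  show int: "integrable lebesgue (\<lambda>v. indicator A v * (g v * (f (u - v) - f v)))"
  proof (rule Bochner_Integration.integrable_bound[OF gi])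
    show "(\<lambda>v. indicator A v * (g v * (f (u - v) - f v))) \<in> borel_measurable lebesgue"
      unfolding eq by (rule borel_measurable_times[OF borel_measurable_integrable[OF g] dm])
    show "AE v in lebesgue. norm (indicator A v * (g v * (f (u - v) - f v)))
        \<le> norm (C * ?S * \<bar>indicator A v * g v\<bar>)"
      unfolding real_norm_def by (intro always_eventually allI order_trans[OF bd abs_ge_self])
  qed
  have "\<bar>LINT v|lebesgue. indicator A v * (g v * (f (u - v) - f v))\<bar>
      \<le> (LINT v|lebesgue. C * ?S * \<bar>indicator A v * g v\<bar>)"
    using Bochner_Integration.integral_norm_bound_integral[OF int gi] bd by simp
  then show "\<bar>LINT v|lebesgue. indicator A v * (g v * (f (u - v) - f v))\<bar>
      \<le> C * (LINT v|lebesgue. \<bar>indicator A v * g v\<bar>) * ?S"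
    by (simp add: mult_ac)
qed

text \<open>By symmetry of \<open>f\<close>, the values f(u - v) and f(-u - v) are f(v - u) and f(v
  + u), so the two integrands add up to \<open>g\<close> times a second difference centred at
  \<open>v\<close>.\<close>

lemma integral_indicator_mult_second_difference_le:
  fixes f g :: "real ^ 'd \<Rightarrow> real"
  assumes f: "twice_differentiable f" and sym: "\<And>x. f (- x) = f x"
    and C1: "\<And>i x. \<bar>partial_deriv i f x\<bar> \<le> C1"
    and C2: "\<And>i j x. \<bar>partial_deriv i (partial_deriv j f) x\<bar> \<le> C2"
    and g: "integrable lebesgue (\<lambda>v. indicator A v * g v)"
  shows "\<bar>(LINT v|lebesgue. indicator A v * (g v * (f (u - v) - f v)))
      + (LINT v|lebesgue. indicator A v * (g v * (f (- u - v) - f v)))\<bar>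
    \<le> 2 * C2 * (LINT v|lebesgue. \<bar>indicator A v * g v\<bar>) * (\<Sum>i\<in>UNIV. \<bar>u $ i\<bar>)\<^sup>2"
proof -
  let ?S = "\<Sum>i\<in>UNIV. \<bar>u $ i\<bar>"
  have f1: "f differentiable (at x)" for x using f by (simp add: twice_differentiable_def)
  note int = integrable_indicator_mult_difference[OF f1 sym C1 g]
  have sum: "indicator A v * (g v * (f (u - v) - f v)) + indicator A v * (g v * (f (- u - v) - f v))
      = (indicator A v * g v) * (f (v + u) + f (v - u) - 2 * f v)" for v
    using sym[of "u - v"] sym[of "- u - v"] by (simp add: algebra_simps)
  have "\<bar>(LINT v|lebesgue. indicator A v * (g v * (f (u - v) - f v)))
      + (LINT v|lebesgue. indicator A v * (g v * (f (- u - v) - f v)))\<bar>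
      = norm (LINT v|lebesgue. indicator A v * (g v * (f (u - v) - f v)) + indicator A v * (g v * (f (- u - v) - f v)))"
    using int by simp
  also have "\<dots> \<le> (LINT v|lebesgue. 2 * C2 * ?S\<^sup>2 * \<bar>indicator A v * g v\<bar>)"
  proof (rule Bochner_Integration.integral_norm_bound_integral)
    fix v
    show "norm (indicator A v * (g v * (f (u - v) - f v)) + indicator A v * (g v * (f (- u - v) - f v)))
        \<le> 2 * C2 * ?S\<^sup>2 * \<bar>indicator A v * g v\<bar>"
      unfolding sum real_norm_def abs_mult[of "indicator A v * g v"]
      using mult_left_mono[OF second_difference_le[OF f C2], of "\<bar>indicator A v * g v\<bar>" v u]
      by (simp add: mult_ac)
  qed (use g int in \<open>auto intro!: integrable_mult_right integrable_abs\<close>)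
  finally show ?thesis by (simp add: mult_ac)
qed

text \<open>Here the smallness comes from the L1 norm of the difference of \<open>f\<close> instead
  of from its supremum. The bound is therefore independent of \<open>A\<close>, and no volume of the
  box enters the 1/lam term.\<close>

lemma integral_indicator_bounded_mult_difference_le:
  fixes f g :: "real ^ 'd \<Rightarrow> real"
  assumes f: "twice_differentiable f" and sym: "\<And>x. f (- x) = f x"
    and f_int: "\<And>i. integrable lebesgue (\<lambda>x. \<bar>partial_deriv i f x\<bar>)"
    and G: "\<And>v. \<bar>g v\<bar> \<le> G"
  shows "\<bar>LINT v|lebesgue. indicator A v * (g v * (f (u - v) - f v))\<bar>
    \<le> G * (\<Sum>i\<in>UNIV. LINT x|lebesgue. \<bar>partial_deriv i f x\<bar>) * (\<Sum>i\<in>UNIV. \<bar>u $ i\<bar>)"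
proof -
  define I where "I i = (LINT x|lebesgue. \<bar>partial_deriv i f x\<bar>)" for i
  have I0: "0 \<le> I i" for i unfolding I_def by (rule Bochner_Integration.integral_nonneg) simp
  have I: "(\<integral>\<^sup>+x. ennreal \<bar>partial_deriv i f x\<bar> \<partial>lborel) = ennreal (I i)" for i
    using nn_integral_eq_integral[OF f_int[of i]] by (simp add: nn_integral_completion I_def)
  have G0: "0 \<le> G" using G abs_ge_zero order_trans by blast
  have "f differentiable (at x)" for x using f by (simp add: twice_differentiable_def)
  then have "continuous_on UNIV f"
    by (intro continuous_at_imp_continuous_on ballI differentiable_imp_continuous_within)
  then have [measurable]: "f \<in> borel_measurable borel" by (rule borel_measurable_continuous_onI)
  have "(\<integral>\<^sup>+v. ennreal (norm (indicator A v * (g v * (f (u - v) - f v)))) \<partial>lebesgue)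
      \<le> (\<integral>\<^sup>+v. ennreal G * ennreal \<bar>f (v + - u) - f v\<bar> \<partial>lborel)"
    unfolding nn_integral_completion
  proof (intro nn_integral_mono)
    fix v
    have "norm (indicator A v * (g v * (f (u - v) - f v))) \<le> \<bar>g v\<bar> * \<bar>f (u - v) - f v\<bar>"
      by (simp add: indicator_def abs_mult)
    also have "\<dots> \<le> G * \<bar>f (v + - u) - f v\<bar>"
      using sym[of "u - v"] G by (simp add: mult_right_mono)
    finally show "ennreal (norm (indicator A v * (g v * (f (u - v) - f v)))) \<le> ennreal G * ennreal \<bar>f (v + - u) - f v\<bar>"
      using G0 by (simp add: ennreal_leI flip: ennreal_mult')
  qed
  also have "\<dots> = ennreal G * (\<integral>\<^sup>+v. ennreal \<bar>f (v + - u) - f v\<bar> \<partial>lborel)"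
    by (rule nn_integral_cmult) measurable
  also have "\<dots> \<le> ennreal G * (\<Sum>i\<in>UNIV. ennreal \<bar>(- u) $ i\<bar> * ennreal (I i))"
    using nn_integral_difference_le[OF f, of "- u"] unfolding I by (rule mult_left_mono) simp
  also have "\<dots> = ennreal (G * (\<Sum>i\<in>UNIV. \<bar>u $ i\<bar> * I i))"
    using G0 I0 by (simp add: sum_ennreal flip: ennreal_mult')
  also have "\<dots> \<le> ennreal (G * (\<Sum>i\<in>UNIV. I i) * (\<Sum>i\<in>UNIV. \<bar>u $ i\<bar>))"
  proof -
    have "(\<Sum>i\<in>UNIV. \<bar>u $ i\<bar> * I i) \<le> (\<Sum>i\<in>UNIV. \<bar>u $ i\<bar> * (\<Sum>i\<in>UNIV. I i))"
      by (intro sum_mono mult_left_mono member_le_sum) (auto simp: I0)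
    also have "\<dots> = (\<Sum>i\<in>UNIV. I i) * (\<Sum>i\<in>UNIV. \<bar>u $ i\<bar>)"
      by (subst sum_distrib_right[symmetric]) (rule mult.commute)
    finally show ?thesis
      using G0 by (intro ennreal_leI) (simp add: mult.assoc mult_left_mono)
  qed
  finally have "norm (LINT v|lebesgue. indicator A v * (g v * (f (u - v) - f v)))
      \<le> G * (\<Sum>i\<in>UNIV. I i) * (\<Sum>i\<in>UNIV. \<bar>u $ i\<bar>)"
    using G0 I0 by (intro norm_integral_le_nn_integral mult_nonneg_nonneg sum_nonneg) auto
  then show ?thesis by (simp add: I_def)
qed

section \<open>Volume of the frequency box\<close>

lemma max_width_ge: "b1 $ i \<le> max_width b1 b2" "b2 $ i \<le> max_width b1 b2"
  unfolding max_width_def by (auto intro!: Max_ge)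

lemma measure_width_box_le:
  fixes b1 b2 :: "real ^ 'd"
  assumes "\<And>i. 0 < b1 $ i" "\<And>i. 0 < b2 $ i"
  shows "measure lebesgue (cbox (- b1) b2) \<le> 2 ^ CARD('d) * max_width b1 b2 ^ CARD('d)"
proof -
  have "(- b1) $ i \<le> b2 $ i" for i using assms[of i] by simp
  then have "measure lebesgue (cbox (- b1) b2) = (\<Prod>i\<in>UNIV. b2 $ i - (- b1) $ i)"
    using content_cbox_cart[of "- b1" b2] by (simp add: interval_ne_empty_cart)
  also have "\<dots> \<le> (\<Prod>i\<in>(UNIV::'d set). 2 * max_width b1 b2)"
  proof (intro prod_mono conjI)
    fix i
    show "0 \<le> b2 $ i - (- b1) $ i" "b2 $ i - (- b1) $ i \<le> 2 * max_width b1 b2"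
      using assms[of i] max_width_ge[of b1 i b2] max_width_ge[of b2 i b1] max_width_ge(2)[of b2 i b1]
      by auto
  qed
  finally show ?thesis by (simp add: power_mult_distrib)
qed

section \<open>The remainder bound\<close>

text \<open>Each case feeds a bound on the inner integral into
  \<open>freq_window_integral_le\<close>: second order for zero frequency, first order otherwise. In
  the bounded case \<open>g\<close> is taken Lebesgue measurable, so that the inner integral over
  the box is meaningful.\<close>

theorem proposition3p7:
  fixes f h :: "real ^ 'd \<Rightarrow> real" and C1 C2 :: real
  assumes f_pos: "\<And>\<omega>. 0 < f \<omega>"
    and f_sym: "\<And>\<omega>. f (- \<omega>) = f \<omega>"
    and f_diff: "twice_differentiable f"
    and C_pos: "0 < C1" "0 < C2"
    and f_d1: "\<And>i \<omega>. \<bar>partial_deriv i f \<omega>\<bar> \<le> C1"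
    and f_d2: "\<And>i j \<omega>. \<bar>partial_deriv i (partial_deriv j f) \<omega>\<bar> \<le> C2"
    and f_int: "\<And>i. integrable lebesgue (\<lambda>\<omega>. \<bar>partial_deriv i f \<omega>\<bar>)"
    and h_taper: "taper h"
  shows "\<exists>C>0. \<forall>(b1 :: real ^ 'd) (b2 :: real ^ 'd) (lam :: real) (m :: int ^ 'd) (g :: real ^ 'd \<Rightarrow> real).
    (\<forall>i. 0 < b1 $ i) \<and> (\<forall>i. 0 < b2 $ i) \<and> 1 \<le> lam \<longrightarrow>
      (g \<in> borel_measurable lebesgue \<and> bounded (range g) \<longrightarrow>
        remainder f h g b1 b2 lam m \<le>
          C * (SUP v. \<bar>g v\<bar>) *
            (if \<forall>i. m $ i = 0 then max_width b1 b2 ^ CARD('d) / lam\<^sup>2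
             else 1 / lam + max_width b1 b2 ^ CARD('d) / lam\<^sup>2)) \<and>
      (integrable lebesgue g \<longrightarrow>
        remainder f h g b1 b2 lam m \<le>
          C * (LINT v | lebesgue. \<bar>g v\<bar>) *
            (if \<forall>i. m $ i = 0 then 1 / lam\<^sup>2 else 1 / lam))"
proof -
  obtain K where "0 < K"
    and K1: "\<And>lam w F M. 0 < lam \<Longrightarrow> 0 \<le> M \<Longrightarrow> (\<And>u. \<bar>F u\<bar> \<le> M * (\<Sum>i\<in>UNIV. \<bar>u $ i\<bar>)) \<Longrightarrow>
      cmod (LINT u|lebesgue. freq_window lam h u * freq_window lam h (w - u) * complex_of_real (F u))
        \<le> lam ^ CARD('d) * (K * M / lam)"
    and K2: "\<And>lam F M. 0 < lam \<Longrightarrow> 0 \<le> M \<Longrightarrow>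
      (\<And>u. \<bar>F u + F (- u)\<bar> \<le> M * (\<Sum>i\<in>UNIV. \<bar>u $ i\<bar>)\<^sup>2) \<Longrightarrow>
      cmod (LINT u|lebesgue. freq_window lam h u * freq_window lam h (- u) * complex_of_real (F u))
        \<le> lam ^ CARD('d) * (K * M / lam\<^sup>2)"
    using freq_window_integral_le[OF h_taper] by blast
  have f1: "f differentiable (at x)" for x using f_diff by (simp add: twice_differentiable_def)
  define D where "D = (\<Sum>i\<in>UNIV. LINT x|lebesgue. \<bar>partial_deriv i f x\<bar>)"
  have D: "0 \<le> D" unfolding D_def by (intro sum_nonneg Bochner_Integration.integral_nonneg) simp
  \<comment> \<open>\<open>L\<close> dominates the coefficients of all four cases: \<open>C1\<close>
    and \<open>2 * C2\<close> for integrable \<open>g\<close>, and \<open>D\<close> and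
    \<open>2 * C2 * 2 ^ CARD('d)\<close> for bounded \<open>g\<close>, where the power of 2 comes
    from the box volume. None of them depends on the box, the scale, \<open>m\<close> or
    \<open>g\<close>.\<close>
  define L where "L = C1 + 2 * C2 * 2 ^ CARD('d) + D"
  have "0 < 2 * C2 * 2 ^ CARD('d)" using C_pos by simp
  then have L: "0 < L" "C1 \<le> L" "2 * C2 * 2 ^ CARD('d) \<le> L" "D \<le> L"
    unfolding L_def using C_pos D by linarith+
  have "2 * C2 * 1 \<le> 2 * C2 * 2 ^ CARD('d)" using C_pos by (intro mult_left_mono) simp_all
  then have L': "2 * C2 \<le> L" using L by simp
  show ?thesis
  proof (intro exI[of _ "K * L"] conjI allI impI; (elim conjE)?)
    show "0 < K * L" using \<open>0 < K\<close> L by simp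
    fix b1 b2 :: "real ^ 'd" and lam :: real and m :: "int ^ 'd" and g :: "real ^ 'd \<Rightarrow> real"
    assume b1: "\<forall>i. 0 < b1 $ i" and b2: "\<forall>i. 0 < b2 $ i" and "1 \<le> lam"
    then have lam: "0 < lam" by simp
    let ?A = "cbox (- b1) b2"
    define b where "b = max_width b1 b2 ^ CARD('d)"
    have b: "0 < b"
      \<comment> \<open>Any coordinate will do, and \<open>undefined\<close> serves as one.\<close>
      unfolding b_def using max_width_ge(1)[of b1 undefined b2] b1 by (intro zero_less_power) (auto intro: less_le_trans)
    define F where "F u = (LINT v|lebesgue. indicator ?A v * (g v * (f (u - v) - f v)))" for u
    have rem: "remainder f h g b1 b2 lam m = 1 / lam ^ CARD('d) *
        cmod (LINT u|lebesgue. freq_window lam h u * freq_window lam h (fourier_freq m lam - u) * complex_of_real (F u))"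
      by (simp add: remainder_def set_lebesgue_integral_def F_def)
    \<comment> \<open>\<open>M\<close> may depend on \<open>g\<close> and the box. The factor lam^d
      from the windows cancels against the normalization of \<open>remainder\<close>.\<close>
    have first_order: "remainder f h g b1 b2 lam m \<le> K * M / lam"
      if "0 \<le> M" "\<And>u. \<bar>F u\<bar> \<le> M * (\<Sum>i\<in>UNIV. \<bar>u $ i\<bar>)" for M
      using K1[OF lam that] lam unfolding rem by (simp add: field_simps)
    have second_order: "remainder f h g b1 b2 lam m \<le> K * M / lam\<^sup>2"
      if "\<forall>i. m $ i = 0" "0 \<le> M" "\<And>u. \<bar>F u + F (- u)\<bar> \<le> M * (\<Sum>i\<in>UNIV. \<bar>u $ i\<bar>)\<^sup>2" for M
    proof -
      have "fourier_freq m lam = 0" using that(1) by (simp add: fourier_freq_def vec_eq_iff)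
      then show ?thesis using K2[OF lam that(2,3)] lam unfolding rem by (simp add: field_simps)
    qed
    define N where "N = (LINT v|lebesgue. \<bar>indicator ?A v * g v\<bar>)"
    have N: "0 \<le> N" unfolding N_def by (rule Bochner_Integration.integral_nonneg) simp
    have A: "?A \<in> sets lebesgue" "emeasure lebesgue ?A < \<infinity>"
      using emeasure_lborel_cbox_finite[of "- b1" b2] by simp_all
    {
      assume g: "g \<in> borel_measurable lebesgue" "bounded (range g)"
      define G where "G = (SUP v. \<bar>g v\<bar>)"
      have "bdd_above (range (\<lambda>v. \<bar>g v\<bar>))"
        using g(2) by (auto simp: bounded_iff bdd_above_def)
      then have gG: "\<bar>g v\<bar> \<le> G" for v unfolding G_def by (rule cSUP_upper[OF UNIV_I])
      have G: "0 \<le> G" using gG[of 0] by simp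
      have iG: "integrable lebesgue (\<lambda>v. G * indicator ?A v)"
        using A by (intro integrable_mult_right) simp
      have gA: "\<bar>indicator ?A v * g v\<bar> \<le> G * indicator ?A v" for v
        using gG by (simp add: indicator_def)
      have int: "integrable lebesgue (\<lambda>v. indicator ?A v * g v)"
      proof (rule Bochner_Integration.integrable_bound[OF iG])
        show "(\<lambda>v. indicator ?A v * g v) \<in> borel_measurable lebesgue"
          by (intro borel_measurable_times borel_measurable_indicator A g)
        show "AE v in lebesgue. norm (indicator ?A v * g v) \<le> norm (G * indicator ?A v)"
          unfolding real_norm_def by (intro always_eventually allI order_trans[OF gA abs_ge_self])
      qed
      show "remainder f h g b1 b2 lam m \<le> K * L * (SUP v. \<bar>g v\<bar>) *
          (if \<forall>i. m $ i = 0 then max_width b1 b2 ^ CARD('d) / lam\<^sup>2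
           else 1 / lam + max_width b1 b2 ^ CARD('d) / lam\<^sup>2)"
      proof (cases "\<forall>i. m $ i = 0")
        case True
        \<comment> \<open>The factor b^d enters here: the L1 norm of a bounded function on the box
          is at most its supremum times the volume.\<close>
        have "N \<le> (LINT v|lebesgue. G * indicator ?A v)"
          unfolding N_def using int iG gA by (intro integral_mono integrable_abs)
        also have "\<dots> = G * measure lebesgue ?A" using A by simp
        also have "\<dots> \<le> G * (2 ^ CARD('d) * b)"
          unfolding b_def using b1 b2 G by (intro mult_left_mono measure_width_box_le) auto
        finally have "2 * C2 * N \<le> 2 * C2 * (G * (2 ^ CARD('d) * b))"
          using C_pos by (intro mult_left_mono) simp_all
        also have "\<dots> = (2 * C2 * 2 ^ CARD('d)) * (G * b)" by simp
        also have "\<dots> \<le> L * (G * b)" using L G b by (intro mult_right_mono) auto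
        finally have "K * (2 * C2 * N) / lam\<^sup>2 \<le> K * (L * (G * b)) / lam\<^sup>2"
          using \<open>0 < K\<close> by (intro divide_right_mono mult_left_mono) auto
        moreover have "remainder f h g b1 b2 lam m \<le> K * (2 * C2 * N) / lam\<^sup>2"
          using C_pos N integral_indicator_mult_second_difference_le[OF f_diff f_sym f_d1 f_d2 int]
          unfolding N_def F_def by (intro second_order[unfolded F_def] True) auto
        ultimately show ?thesis using True by (simp add: G_def b_def mult_ac)
      next
        case False
        have "remainder f h g b1 b2 lam m \<le> K * (G * D) / lam"
          using G D integral_indicator_bounded_mult_difference_le[OF f_diff f_sym f_int gG]
          unfolding D_def F_def by (intro first_order[unfolded F_def]) auto
        also have "\<dots> \<le> K * (G * L) / lam"
          using \<open>0 < K\<close> G L lam by (intro divide_right_mono mult_left_mono) auto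
        also have "\<dots> = K * L * G * (1 / lam)" by simp
        \<comment> \<open>The nonnegative term b / lam^2 is added to reach the claimed form.\<close>
        also have "\<dots> \<le> K * L * G * (1 / lam + b / lam\<^sup>2)"
          using \<open>0 < K\<close> G L b lam by (intro mult_left_mono) auto
        finally show ?thesis unfolding if_not_P[OF False] G_def b_def .
      qed
    }
    {
      assume g: "integrable lebesgue g"
      define J where "J = (LINT v|lebesgue. \<bar>g v\<bar>)"
      have int: "integrable lebesgue (\<lambda>v. indicator ?A v * g v)"
        using integrable_mult_indicator[OF A(1) g] by simp
      have "N \<le> J"
        unfolding N_def J_def using int g by (intro integral_mono integrable_abs) (auto simp: indicator_def)
      then have J: "0 \<le> J" using N by simp
      show "remainder f h g b1 b2 lam m \<le> K * L * (LINT v|lebesgue. \<bar>g v\<bar>) *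
          (if \<forall>i. m $ i = 0 then 1 / lam\<^sup>2 else 1 / lam)"
      proof (cases "\<forall>i. m $ i = 0")
        case True
        have "remainder f h g b1 b2 lam m \<le> K * (2 * C2 * N) / lam\<^sup>2"
          using C_pos N integral_indicator_mult_second_difference_le[OF f_diff f_sym f_d1 f_d2 int]
          unfolding N_def F_def by (intro second_order[unfolded F_def] True) auto
        also have "\<dots> \<le> K * (L * J) / lam\<^sup>2"
          using \<open>0 < K\<close> \<open>N \<le> J\<close> N L' L by (intro divide_right_mono mult_left_mono mult_mono) auto
        finally show ?thesis unfolding if_P[OF True] J_def by simp
      next
        case False
        \<comment> \<open>For integrable \<open>g\<close> the uniform Lipschitz bound is enough,
          since \<open>N\<close> is at most the full L1 norm \<open>J\<close> whatever the
          box.\<close>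
        have "remainder f h g b1 b2 lam m \<le> K * (C1 * N) / lam"
          using C_pos N integral_indicator_mult_difference_le[OF f1 f_sym f_d1 int]
          unfolding N_def F_def by (intro first_order[unfolded F_def]) auto
        also have "\<dots> \<le> K * (L * J) / lam"
          using \<open>0 < K\<close> \<open>N \<le> J\<close> N L lam by (intro divide_right_mono mult_left_mono mult_mono) auto
        finally show ?thesis unfolding if_not_P[OF False] J_def by simp
      qed
    }
  qed
qed

end
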